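(* Let $T$ and $A$ be two contractions acting on a Hilbert space $\mathcal{H}$ such that $T \perp_B A$. Then there are unitary dilations $\widehat{U_T}$ of $T$ and $\widehat{U_A}$ of $A$ on some Hilbert space $\widehat{\mathcal{K}}\supseteq \mathcal{H}$ such that $\widehat{U_T}\perp_B \widehat{U_A}$.
   Context: All Hilbert spaces are complex and separable, and all operators are bounded and linear; a contraction is an operator of norm at most $1$. For operators $X,Y$ on the same Hilbert space, $X\perp_B Y$ (Birkhoff-James orthogonality) means $\|X+\lambda Y\|\ge\|X\|$ for every $\lambda\in\mathbb{C}$ (operator norm). A unitary operator $U$ on a Hilbert space $\mathcal{K}\supseteq\mathcal{H}$ is a unitary dilation of $T\in\mathcal{B}(\mathcal{H})$ if $T^n=P_{\mathcal{H}}U^n|_{\mathcal{H}}$ for every integer $n\ge 0$, where $P_{\mathcal{H}}:\mathcal{K}\to\mathcal{H}$ is the orthogonal projection. *)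

theory Defs
  imports "HOL-Analysis.Analysis" "HOL-Library.Function_Algebras"
begin

section \<open>Separable complex Hilbert spaces\<close>

text \<open>
  A space is given by a linear subspace \<open>carrier H\<close> of an ambient complex vector space (a type of
  class \<^class>\<open>ab_group_add\<close> with scalar multiplication \<open>scl H\<close>) and an inner product on that
  subspace. Only the linear structure comes from the ambient type; the values of \<open>ip H\<close> outside the
  carrier are irrelevant. Carriers, rather than whole types, are used because HOL cannot quantify
  existentially over types.
\<close>

record 'a cspace =
  carrier :: "'a set"
  scl :: "complex \<Rightarrow> 'a \<Rightarrow> 'a"
  ip :: "'a \<Rightarrow> 'a \<Rightarrow> complex"

definition vnorm :: "'a cspace \<Rightarrow> 'a \<Rightarrow> real" where
  "vnorm H x = sqrt (Re (ip H x x))"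

text \<open>The guard makes the distance total, as \<^locale>\<open>Metric_space\<close> asks for nonnegativity and symmetry
  on the whole type.\<close>

definition vdist :: "('a::ab_group_add) cspace \<Rightarrow> 'a \<Rightarrow> 'a \<Rightarrow> real" where
  "vdist H x y = (if x \<in> carrier H \<and> y \<in> carrier H then vnorm H (x - y) else 0)"

locale complex_inner_product_space = vector_space "scl H"
  for H :: "('a::ab_group_add) cspace" +
  assumes subspace_carrier: "subspace (carrier H)"
    and ip_add_left: "\<lbrakk>x \<in> carrier H; y \<in> carrier H; z \<in> carrier H\<rbrakk>
          \<Longrightarrow> ip H (x + y) z = ip H x z + ip H y z"
    and ip_scl_left: "\<lbrakk>x \<in> carrier H; y \<in> carrier H\<rbrakk> \<Longrightarrow> ip H (scl H c x) y = c * ip H x y"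
    and ip_commute: "\<lbrakk>x \<in> carrier H; y \<in> carrier H\<rbrakk> \<Longrightarrow> ip H x y = cnj (ip H y x)"
    and ip_nonneg: "x \<in> carrier H \<Longrightarrow> 0 \<le> Re (ip H x x)"
    and ip_definite: "\<lbrakk>x \<in> carrier H; ip H x x = 0\<rbrakk> \<Longrightarrow> x = 0"
begin

lemma zero_in [simp]: "0 \<in> carrier H"
  using subspace_carrier by (rule subspace_0)

lemma add_in [simp]: "\<lbrakk>x \<in> carrier H; y \<in> carrier H\<rbrakk> \<Longrightarrow> x + y \<in> carrier H"
  using subspace_carrier by (rule subspace_add)

lemma scl_in [simp]: "x \<in> carrier H \<Longrightarrow> scl H c x \<in> carrier H"
  using subspace_carrier by (rule subspace_scale)

lemma diff_in [simp]: "\<lbrakk>x \<in> carrier H; y \<in> carrier H\<rbrakk> \<Longrightarrow> x - y \<in> carrier H"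
  using subspace_carrier by (rule subspace_diff)

lemma ip_add_right:
  "\<lbrakk>x \<in> carrier H; y \<in> carrier H; z \<in> carrier H\<rbrakk> \<Longrightarrow> ip H x (y + z) = ip H x y + ip H x z"
  by (metis add_in complex_cnj_add ip_add_left ip_commute)

lemma ip_scl_right:
  "\<lbrakk>x \<in> carrier H; y \<in> carrier H\<rbrakk> \<Longrightarrow> ip H x (scl H c y) = cnj c * ip H x y"
  by (metis complex_cnj_mult ip_commute ip_scl_left scl_in)

lemma ip_zero_left [simp]: "x \<in> carrier H \<Longrightarrow> ip H 0 x = 0"
  using ip_scl_left[of 0 x 0] by simp

lemma ip_zero_right [simp]: "x \<in> carrier H \<Longrightarrow> ip H x 0 = 0"
  using ip_scl_right[of x 0 0] by simp

lemma Im_ip_self: "x \<in> carrier H \<Longrightarrow> Im (ip H x x) = 0"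
  using ip_commute[of x x] by (simp add: complex_eq_iff)

lemma vnorm_nonneg: "x \<in> carrier H \<Longrightarrow> 0 \<le> vnorm H x"
  by (simp add: vnorm_def ip_nonneg)

lemma vnorm_power2: "x \<in> carrier H \<Longrightarrow> (vnorm H x)\<^sup>2 = Re (ip H x x)"
  by (simp add: vnorm_def ip_nonneg)

lemma vnorm_eq_0_iff: "x \<in> carrier H \<Longrightarrow> vnorm H x = 0 \<longleftrightarrow> x = 0"
  using ip_definite[of x] Im_ip_self[of x] by (auto simp: vnorm_def complex_eq_iff)

lemma vnorm_add_power2:
  assumes x: "x \<in> carrier H" and y: "y \<in> carrier H"
  shows "(vnorm H (x + y))\<^sup>2 = (vnorm H x)\<^sup>2 + 2 * Re (ip H x y) + (vnorm H y)\<^sup>2"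
proof -
  have "Re (ip H y x) = Re (ip H x y)"
    using ip_commute[OF x y] by simp
  then show ?thesis
    using x y by (simp add: vnorm_power2 ip_add_left ip_add_right)
qed

lemma Re_ip_le:
  assumes x: "x \<in> carrier H" and y: "y \<in> carrier H"
  shows "Re (ip H x y) \<le> vnorm H x * vnorm H y"
proof (cases "y = 0")
  case True
  then show ?thesis using x by (simp add: vnorm_def)
next
  case False
  define b where "b = Re (ip H x y)"
  define c where "c = Re (ip H y y)"
  have c: "c > 0"
    using False ip_nonneg[OF y] vnorm_eq_0_iff[OF y] by (auto simp: c_def vnorm_def less_le)
  define t where "t = - b / c"
  have ty: "scl H (of_real t) y \<in> carrier H" using y by simp
  have "0 \<le> (vnorm H (x + scl H (of_real t) y))\<^sup>2" by simp
  also have "\<dots> = (vnorm H x)\<^sup>2 + 2 * (t * b) + t * (t * c)"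
    using x y vnorm_add_power2[OF x ty] vnorm_power2[OF ty]
    by (simp add: ip_scl_left ip_scl_right b_def c_def)
  also have "\<dots> = (vnorm H x)\<^sup>2 - b\<^sup>2 / c"
    using c by (simp add: t_def field_simps power2_eq_square)
  finally have "b\<^sup>2 \<le> (vnorm H x)\<^sup>2 * c"
    using c by (simp add: field_simps)
  then have "b\<^sup>2 \<le> (vnorm H x * vnorm H y)\<^sup>2"
    using y by (simp add: power_mult_distrib vnorm_power2 c_def)
  then show ?thesis
    using x y unfolding b_def by (metis mult_nonneg_nonneg power2_le_imp_le vnorm_nonneg)
qed

lemma vnorm_triangle:
  assumes x: "x \<in> carrier H" and y: "y \<in> carrier H"
  shows "vnorm H (x + y) \<le> vnorm H x + vnorm H y"
proof (rule power2_le_imp_le)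
  show "(vnorm H (x + y))\<^sup>2 \<le> (vnorm H x + vnorm H y)\<^sup>2"
    using Re_ip_le[OF x y] by (simp add: vnorm_add_power2[OF x y] power2_sum)
  show "0 \<le> vnorm H x + vnorm H y"
    using x y by (simp add: vnorm_nonneg)
qed

lemma vnorm_minus_commute:
  assumes "x \<in> carrier H" "y \<in> carrier H"
  shows "vnorm H (x - y) = vnorm H (y - x)"
proof -
  have "x - y = scl H (-1) (y - x)" by simp
  then show ?thesis
    using assms by (simp add: vnorm_def ip_scl_left ip_scl_right del: scale_minus_left)
qed

sublocale vmetric: Metric_space "carrier H" "vdist H"
proof
  show "0 \<le> vdist H x y" for x y
    by (simp add: vdist_def vnorm_nonneg)
  show "vdist H x y = vdist H y x" for x y
    by (simp add: vdist_def vnorm_minus_commute)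
  show "vdist H x y = 0 \<longleftrightarrow> x = y" if "x \<in> carrier H" "y \<in> carrier H" for x y
    using that by (simp add: vdist_def vnorm_eq_0_iff)
  show "vdist H x z \<le> vdist H x y + vdist H y z"
    if "x \<in> carrier H" "y \<in> carrier H" "z \<in> carrier H" for x y z
    using that vnorm_triangle[of "x - y" "y - z"] by (simp add: vdist_def)
qed

end

locale separable_hilbert_space = complex_inner_product_space +
  assumes complete: "vmetric.mcomplete"
    and separable: "separable_space vmetric.mtopology"


section \<open>Bounded operators\<close>

definition linear_on_carrier ::
    "('a::ab_group_add) cspace \<Rightarrow> ('b::ab_group_add) cspace \<Rightarrow> ('a \<Rightarrow> 'b) \<Rightarrow> bool" where
  "linear_on_carrier H K T \<longleftrightarrow>
     (\<forall>x\<in>carrier H. T x \<in> carrier K) \<and>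
     (\<forall>x\<in>carrier H. \<forall>y\<in>carrier H. T (x + y) = T x + T y) \<and>
     (\<forall>c. \<forall>x\<in>carrier H. T (scl H c x) = scl K c (T x))"

definition bounded_operator :: "('a::ab_group_add) cspace \<Rightarrow> ('a \<Rightarrow> 'a) \<Rightarrow> bool" where
  "bounded_operator H T \<longleftrightarrow>
     linear_on_carrier H H T \<and> (\<exists>B. \<forall>x\<in>carrier H. vnorm H (T x) \<le> B * vnorm H x)"

text \<open>The supremum is over the closed unit ball, so it is over a nonempty set also when \<open>H\<close> is the
  zero space.\<close>

definition op_norm :: "'a cspace \<Rightarrow> ('a \<Rightarrow> 'a) \<Rightarrow> real" where
  "op_norm H T = (SUP x\<in>{x \<in> carrier H. vnorm H x \<le> 1}. vnorm H (T x))"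

definition contraction :: "('a::ab_group_add) cspace \<Rightarrow> ('a \<Rightarrow> 'a) \<Rightarrow> bool" where
  "contraction H T \<longleftrightarrow> bounded_operator H T \<and> op_norm H T \<le> 1"

definition bj_orthogonal :: "('a::ab_group_add) cspace \<Rightarrow> ('a \<Rightarrow> 'a) \<Rightarrow> ('a \<Rightarrow> 'a) \<Rightarrow> bool" where
  "bj_orthogonal H X Y \<longleftrightarrow> (\<forall>c::complex. op_norm H (\<lambda>x. X x + scl H c (Y x)) \<ge> op_norm H X)"

definition is_adjoint :: "'a cspace \<Rightarrow> ('a \<Rightarrow> 'a) \<Rightarrow> ('a \<Rightarrow> 'a) \<Rightarrow> bool" where
  "is_adjoint H T S \<longleftrightarrow> (\<forall>x\<in>carrier H. \<forall>y\<in>carrier H. ip H (T x) y = ip H x (S y))"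

definition unitary :: "('a::ab_group_add) cspace \<Rightarrow> ('a \<Rightarrow> 'a) \<Rightarrow> bool" where
  "unitary H U \<longleftrightarrow>
     bounded_operator H U \<and>
     (\<exists>V. bounded_operator H V \<and> is_adjoint H U V \<and>
        (\<forall>x\<in>carrier H. V (U x) = x) \<and> (\<forall>x\<in>carrier H. U (V x) = x))"


section \<open>Unitary dilations\<close>

text \<open>The inclusion of \<open>H\<close> in \<open>K\<close> is a linear isometry \<open>J\<close>, which identifies \<open>H\<close> with the closed
  subspace \<open>J ` carrier H\<close> of \<open>K\<close>.\<close>

definition isometric_embedding ::
    "('a::ab_group_add) cspace \<Rightarrow> ('b::ab_group_add) cspace \<Rightarrow> ('a \<Rightarrow> 'b) \<Rightarrow> bool" where
  "isometric_embedding H K J \<longleftrightarrow>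
     linear_on_carrier H K J \<and>
     (\<forall>x\<in>carrier H. \<forall>y\<in>carrier H. ip K (J x) (J y) = ip H x y)"

text \<open>For a closed subspace \<open>M\<close> of a Hilbert space there is exactly one such \<open>p\<close>.\<close>

definition orth_proj :: "('a::ab_group_add) cspace \<Rightarrow> 'a set \<Rightarrow> 'a \<Rightarrow> 'a" where
  "orth_proj K M x = (THE p. p \<in> M \<and> (\<forall>m\<in>M. ip K (x - p) m = 0))"

definition unitary_dilation ::
    "('a::ab_group_add) cspace \<Rightarrow> ('b::ab_group_add) cspace \<Rightarrow> ('a \<Rightarrow> 'b) \<Rightarrow>
     ('a \<Rightarrow> 'a) \<Rightarrow> ('b \<Rightarrow> 'b) \<Rightarrow> bool" where
  "unitary_dilation H K J T U \<longleftrightarrow>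
     unitary K U \<and>
     (\<forall>n::nat. \<forall>x\<in>carrier H.
        J ((T ^^ n) x) = orth_proj K (J ` carrier H) ((U ^^ n) (J x)))"

text \<open>Every separable complex Hilbert space is isomorphic to a linear subspace of the complex
  sequences (a subspace of \<open>\<ell>\<^sup>2\<close>), with \<^typ>\<open>nat \<Rightarrow> complex\<close> an abelian group under pointwise
  addition. Hence an existential over \<open>(nat \<Rightarrow> complex) cspace\<close> is one over all separable Hilbert
  spaces up to isomorphism.\<close>

end

theory Submission
  imports Defs
begin

text \<open>
  A direct summand does not disturb a unitary dilation: if \<open>U\<close> dilates \<open>T\<close>, then so does
  \<open>U \<oplus> W\<close> for every unitary \<open>W\<close>. Birkhoff--James orthogonality, on the other hand, is easily
  enforced on a summand. Let \<open>G\<close> be the unitary operator on \<open>\<ell>\<^sup>2\<close> that alternates the signs of the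
  coordinates. For every \<open>c\<close> the norm of \<open>1 + c G\<close> is at least the larger of \<open>\<bar>1 + c\<bar>\<close> and
  \<open>\<bar>1 - c\<bar>\<close>, hence at least \<open>1\<close>. So if \<open>U\<close> and \<open>V\<close> are unitary dilations of \<open>T\<close> and \<open>A\<close> on one
  space, then \<open>U \<oplus> 1\<close> and \<open>V \<oplus> G\<close> are orthogonal unitary dilations
  (\<open>bj_orthogonal_direct_sum\<close>).

  What remains is to construct unitary dilations of \<open>T\<close> and \<open>A\<close> on one space with one embedding of
  \<open>H\<close>. Everything is built from a Gram--Schmidt process for a semi-inner product on a separable
  space, whose coefficients give an isometry into \<open>\<ell>\<^sup>2\<close> (\<open>isometry_into_ell2\<close>). Applied to \<open>H\<close>, it
  yields the embedding, along which contractions of \<open>H\<close> extend to contractions of \<open>\<ell>\<^sup>2\<close>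
  (\<open>isometry_extending_contractions\<close>). Applied to the form that measures how far a contraction \<open>S\<close> of
  \<open>\<ell>\<^sup>2\<close> is from being isometric, it completes \<open>S\<close> to an isometry \<open>V\<close> of \<open>\<ell>\<^sup>2 \<oplus> \<ell>\<^sup>2\<close>
  (\<open>isometric_dilation\<close>). The block matrix \<open>[[V, 1 - V V\<^sup>*], [0, V\<^sup>*]]\<close> then is a unitary operator
  that extends \<open>V\<close> (\<open>unitary_extension\<close>). Because these matrices are triangular, powers of the unitary
  operator compress to powers of \<open>S\<close>.
\<close>

section \<open>The Hilbert space of square-summable sequences\<close>

text \<open>
  A type of its own for \<open>\<ell>\<^sup>2\<close> gives access to the convergence theory of \<^class>\<open>real_inner\<close> and
  \<^class>\<open>complete_space\<close>. These classes know real scalars only, so the complex inner product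
  \<open>cinner\<close> and the complex scaling \<open>cscale\<close> are carried alongside; the real inner product is the
  real part of \<open>cinner\<close>.
\<close>

typedef ell2 = "{x :: nat \<Rightarrow> complex. summable (\<lambda>n. (cmod (x n))\<^sup>2)}"
  morphisms coord of_coord
proof
  show "(\<lambda>_. 0) \<in> {x :: nat \<Rightarrow> complex. summable (\<lambda>n. (cmod (x n))\<^sup>2)}" by simp
qed

setup_lifting type_definition_ell2

lemma summable_coord: "summable (\<lambda>n. (cmod (coord x n))\<^sup>2)"
  using coord by simp

lemma square_summable_add:
  assumes "summable (\<lambda>n. (cmod (x n))\<^sup>2)" "summable (\<lambda>n. (cmod (y n))\<^sup>2)"
  shows "summable (\<lambda>n. (cmod (x n + y n))\<^sup>2)"
proof (rule summable_comparison_test')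
  show "summable (\<lambda>n. 2 * (cmod (x n))\<^sup>2 + 2 * (cmod (y n))\<^sup>2)"
    using assms by (intro summable_add summable_mult)
  show "norm ((cmod (x n + y n))\<^sup>2) \<le> 2 * (cmod (x n))\<^sup>2 + 2 * (cmod (y n))\<^sup>2" if "n \<ge> 0" for n
  proof -
    have "(cmod (x n + y n))\<^sup>2 \<le> (cmod (x n) + cmod (y n))\<^sup>2"
      by (simp add: norm_triangle_ineq power_mono)
    also have "\<dots> \<le> 2 * (cmod (x n))\<^sup>2 + 2 * (cmod (y n))\<^sup>2"
      using sum_squares_bound[of "cmod (x n)" "cmod (y n)"] by (simp add: power2_sum)
    finally show ?thesis by simp
  qed
qed

lemma square_summable_scale:
  "summable (\<lambda>n. (cmod (x n))\<^sup>2) \<Longrightarrow> summable (\<lambda>n. (cmod (c * x n))\<^sup>2)"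
  by (simp add: norm_mult power_mult_distrib summable_mult)

lift_definition cscale :: "complex \<Rightarrow> ell2 \<Rightarrow> ell2" is "\<lambda>c x n. c * x n"
  by (rule square_summable_scale)

definition cinner :: "ell2 \<Rightarrow> ell2 \<Rightarrow> complex" where
  "cinner x y = (\<Sum>n. coord x n * cnj (coord y n))"

lemma summable_cinner: "summable (\<lambda>n. coord x n * cnj (coord y n))"
proof (rule summable_comparison_test')
  show "summable (\<lambda>n. (cmod (coord x n))\<^sup>2 + (cmod (coord y n))\<^sup>2)"
    by (intro summable_add summable_coord)
  show "norm (coord x n * cnj (coord y n)) \<le> (cmod (coord x n))\<^sup>2 + (cmod (coord y n))\<^sup>2"
    if "n \<ge> 0" for n
    using sum_squares_bound[of "cmod (coord x n)" "cmod (coord y n)"]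
      mult_nonneg_nonneg[OF norm_ge_zero norm_ge_zero, of "coord x n" "coord y n"]
    unfolding norm_mult complex_mod_cnj by linarith
qed

lemma cinner_sums: "(\<lambda>n. coord x n * cnj (coord y n)) sums cinner x y"
  unfolding cinner_def by (rule summable_sums[OF summable_cinner])

lemma Re_mult_cnj_self: "Re (z * cnj z) = (cmod z)\<^sup>2"
  unfolding cmod_power2 by (simp add: power2_eq_square)

instantiation ell2 :: real_inner
begin

lift_definition zero_ell2 :: ell2 is "\<lambda>_. 0" by simp
lift_definition plus_ell2 :: "ell2 \<Rightarrow> ell2 \<Rightarrow> ell2" is "\<lambda>x y n. x n + y n"
  by (rule square_summable_add)
lift_definition uminus_ell2 :: "ell2 \<Rightarrow> ell2" is "\<lambda>x n. - x n" by simp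
lift_definition minus_ell2 :: "ell2 \<Rightarrow> ell2 \<Rightarrow> ell2" is "\<lambda>x y n. x n - y n"
  using square_summable_add[of _ "\<lambda>n. - _ n"] by simp
lift_definition scaleR_ell2 :: "real \<Rightarrow> ell2 \<Rightarrow> ell2" is "\<lambda>r x n. of_real r * x n"
  by (rule square_summable_scale)

definition "inner_ell2 x y = Re (cinner x y)"
definition "norm_ell2 (x::ell2) = sqrt (inner x x)"
definition "sgn_ell2 (x::ell2) = inverse (norm x) *\<^sub>R x"
definition "dist_ell2 (x::ell2) y = norm (x - y)"
definition "uniformity_ell2 = (INF e\<in>{0 <..}. principal {(x::ell2, y). dist x y < e})"
definition "open_ell2 (U::ell2 set) = (\<forall>x\<in>U. \<forall>\<^sub>F (x', y) in uniformity. x' = x \<longrightarrow> y \<in> U)"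

lemma inner_ell2_sums: "(\<lambda>n. Re (coord x n * cnj (coord y n))) sums inner x y"
  unfolding inner_ell2_def by (rule sums_Re[OF cinner_sums])

instance
proof
  fix x y z :: ell2 and r s :: real and U :: "ell2 set"
  show "x + y + z = x + (y + z)" "x + y = y + x" "0 + x = x" "- x + x = 0" "x - y = x + - y"
    "r *\<^sub>R (x + y) = r *\<^sub>R x + r *\<^sub>R y" "(r + s) *\<^sub>R x = r *\<^sub>R x + s *\<^sub>R x"
    "r *\<^sub>R s *\<^sub>R x = (r * s) *\<^sub>R x" "1 *\<^sub>R x = x"
    by (transfer; simp add: algebra_simps)+
  show "dist x y = norm (x - y)" "sgn x = inverse (norm x) *\<^sub>R x" "norm x = sqrt (inner x x)"
    "uniformity = (INF e\<in>{0 <..}. principal {(x::ell2, y). dist x y < e})"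
    "open U = (\<forall>x\<in>U. \<forall>\<^sub>F (x', y) in uniformity. x' = x \<longrightarrow> y \<in> U)"
    by (simp_all add: dist_ell2_def sgn_ell2_def norm_ell2_def uniformity_ell2_def open_ell2_def)
  have "(\<lambda>n. Re (coord x n * cnj (coord y n))) = (\<lambda>n. Re (coord y n * cnj (coord x n)))"
    by (simp add: mult.commute)
  then show "inner x y = inner y x"
    using inner_ell2_sums[of x y] inner_ell2_sums[of y x] sums_unique2 by metis
  show "inner (x + y) z = inner x z + inner y z"
    by (rule sums_unique2[OF inner_ell2_sums sums_add[OF inner_ell2_sums inner_ell2_sums, THEN sums_cong[THEN iffD1, rotated]]])
       (simp add: plus_ell2.rep_eq algebra_simps)
  show "inner (r *\<^sub>R x) y = r * inner x y"
    by (rule sums_unique2[OF inner_ell2_sums sums_mult[OF inner_ell2_sums, THEN sums_cong[THEN iffD1, rotated]]])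
       (simp add: scaleR_ell2.rep_eq algebra_simps)
  have sq: "(\<lambda>n. (cmod (coord x n))\<^sup>2) sums inner x x"
    using inner_ell2_sums[of x x] by (simp only: Re_mult_cnj_self)
  show "0 \<le> inner x x"
    using sums_le[OF _ sums_zero sq] by simp
  show "inner x x = 0 \<longleftrightarrow> x = 0"
  proof
    assume "inner x x = 0"
    then have "\<forall>n. (cmod (coord x n))\<^sup>2 = 0"
      using sq suminf_eq_zero_iff[OF summable_coord[of x]] by (simp add: sums_iff)
    then show "x = 0"
      by transfer auto
  next
    assume "x = 0"
    then have "(\<lambda>n. 0) sums inner x x"
      using sq by (simp add: zero_ell2.rep_eq)
    then show "inner x x = 0"
      by (rule sums_unique2) (rule sums_zero)
  qed
qed

end

lemma norm_ell2_sums: "(\<lambda>n. (cmod (coord x n))\<^sup>2) sums (norm x)\<^sup>2"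
  using inner_ell2_sums[of x x] by (simp only: Re_mult_cnj_self power2_norm_eq_inner)

lemma coord_simps [simp]:
  "coord 0 n = 0" "coord (x + y) n = coord x n + coord y n" "coord (x - y) n = coord x n - coord y n"
  "coord (- x) n = - coord x n" "coord (cscale c x) n = c * coord x n"
  "coord (r *\<^sub>R x) n = of_real r * coord x n"
  by (simp_all add: zero_ell2.rep_eq plus_ell2.rep_eq minus_ell2.rep_eq uminus_ell2.rep_eq
      cscale.rep_eq scaleR_ell2.rep_eq)

lemma ell2_eqI: "(\<And>n. coord x n = coord y n) \<Longrightarrow> x = y"
  by (metis coord_inject ext)

lemma ell2_of_bounded_sums:
  assumes "\<And>N. (\<Sum>n<N. (cmod (f n))\<^sup>2) \<le> B\<^sup>2" "B \<ge> 0"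
  obtains x where "coord x = f" "norm x \<le> B"
proof -
  have sm: "summable (\<lambda>n. (cmod (f n))\<^sup>2)"
    using assms(1) by (intro summableI_nonneg_bounded[where x = "B\<^sup>2"]) auto
  then have c: "coord (of_coord f) = f"
    by (simp add: of_coord_inverse)
  have "(norm (of_coord f))\<^sup>2 \<le> B\<^sup>2"
    using norm_ell2_sums[of "of_coord f"] assms(1) suminf_le_const[OF sm] c by (simp add: sums_iff)
  then have "norm (of_coord f) \<le> B"
    using assms(2) by (rule power2_le_imp_le)
  with c show thesis by (rule that)
qed

lemma partial_sum_le_norm: "(\<Sum>n<N. (cmod (coord x n))\<^sup>2) \<le> (norm x)\<^sup>2"
  using norm_ell2_sums[of x] sum_le_suminf[OF summable_coord, of "{..<N}" x] by (simp add: sums_iff)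

lemma cmod_coord_le_norm: "cmod (coord x n) \<le> norm x"
proof (rule power2_le_imp_le)
  have "(cmod (coord x n))\<^sup>2 \<le> (\<Sum>k<Suc n. (cmod (coord x k))\<^sup>2)"
    by (rule member_le_sum) auto
  also have "\<dots> \<le> (norm x)\<^sup>2" by (rule partial_sum_le_norm)
  finally show "(cmod (coord x n))\<^sup>2 \<le> (norm x)\<^sup>2" .
qed simp

text \<open>
  A Cauchy sequence converges in every coordinate. Letting one index tend to infinity in the Cauchy
  estimate, for finitely many coordinates at a time, bounds the distance to the coordinatewise
  limit; this bound also puts the limit into \<open>\<ell>\<^sup>2\<close>.
\<close>

instance ell2 :: complete_space
proof
  fix X :: "nat \<Rightarrow> ell2"
  assume X: "Cauchy X"
  have "Cauchy (\<lambda>m. coord (X m) n)" for n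
    unfolding Cauchy_def dist_norm
  proof (intro allI impI)
    fix e :: real
    assume "e > 0"
    then obtain M where "\<forall>m\<ge>M. \<forall>k\<ge>M. norm (X m - X k) < e"
      using X unfolding Cauchy_def dist_norm by blast
    then show "\<exists>M. \<forall>m\<ge>M. \<forall>k\<ge>M. cmod (coord (X m) n - coord (X k) n) < e"
      using cmod_coord_le_norm[of "X _ - X _" n] by (metis coord_simps(3) order.strict_trans1)
  qed
  then have "\<exists>l. (\<lambda>m. coord (X m) n) \<longlonglongrightarrow> l" for n
    by (simp add: Cauchy_convergent_iff convergent_def)
  then obtain l where l: "\<And>n. (\<lambda>m. coord (X m) n) \<longlonglongrightarrow> l n"
    by metis
  have near: "\<exists>M. \<forall>m\<ge>M. \<exists>z. coord z = (\<lambda>n. coord (X m) n - l n) \<and> norm z \<le> e" if "e > 0" for e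
  proof -
    obtain M where M: "\<And>m k. m \<ge> M \<Longrightarrow> k \<ge> M \<Longrightarrow> norm (X m - X k) < e"
      using X \<open>e > 0\<close> unfolding Cauchy_def dist_norm by blast
    have "\<exists>z. coord z = (\<lambda>n. coord (X m) n - l n) \<and> norm z \<le> e" if m: "m \<ge> M" for m
    proof -
      have "(\<Sum>n<N. (cmod (coord (X m) n - l n))\<^sup>2) \<le> e\<^sup>2" for N
      proof (rule tendsto_upperbound)
        show "(\<lambda>k. \<Sum>n<N. (cmod (coord (X m) n - coord (X k) n))\<^sup>2)
            \<longlonglongrightarrow> (\<Sum>n<N. (cmod (coord (X m) n - l n))\<^sup>2)"
          by (intro tendsto_intros l)
        show "\<forall>\<^sub>F k in sequentially. (\<Sum>n<N. (cmod (coord (X m) n - coord (X k) n))\<^sup>2) \<le> e\<^sup>2"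
        proof (rule eventually_sequentiallyI)
          fix k assume "k \<ge> M"
          then have "(norm (X m - X k))\<^sup>2 \<le> e\<^sup>2"
            using M[OF m] by (intro power_mono) (auto simp: less_imp_le)
          then show "(\<Sum>n<N. (cmod (coord (X m) n - coord (X k) n))\<^sup>2) \<le> e\<^sup>2"
            using partial_sum_le_norm[of "X m - X k" N] by simp
        qed
      qed simp
      then show ?thesis
        using ell2_of_bounded_sums[of "\<lambda>n. coord (X m) n - l n" e] \<open>e > 0\<close> by (metis less_imp_le)
    qed
    then show ?thesis by blast
  qed
  obtain M z where "coord z = (\<lambda>n. coord (X M) n - l n)"
    using near[of 1] by auto
  then have lim: "coord (X M - z) = l"
    by (auto simp: fun_eq_iff)
  have "X \<longlonglongrightarrow> X M - z"
  proof (rule LIMSEQ_I)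
    fix e :: real
    assume "e > 0"
    then obtain N where N: "\<And>m. m \<ge> N \<Longrightarrow> \<exists>z. coord z = (\<lambda>n. coord (X m) n - l n) \<and> norm z \<le> e / 2"
      using near[of "e / 2"] by auto
    have "norm (X m - (X M - z)) < e" if m: "m \<ge> N" for m
    proof -
      obtain z' where z': "coord z' = (\<lambda>n. coord (X m) n - l n)" "norm z' \<le> e / 2"
        using N[OF m] by blast
      then have "X m - (X M - z) = z'"
        using lim by (intro ell2_eqI) (auto simp: fun_eq_iff)
      with z'(2) \<open>e > 0\<close> show ?thesis by simp
    qed
    then show "\<exists>N. \<forall>m\<ge>N. norm (X m - (X M - z)) < e" by blast
  qed
  then show "convergent X" by (auto simp: convergent_def)
qed

section \<open>Gram--Schmidt for semi-inner products\<close>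

text \<open>
  Definiteness is dropped because the construction is applied to the defect form
  \<open>\<langle>x, y\<rangle> - \<langle>S x, S y\<rangle>\<close> of a contraction \<open>S\<close>, which vanishes wherever \<open>S\<close> preserves the norm.
\<close>

locale semi_inner_product = vector_space scl
  for scl :: "complex \<Rightarrow> 'a::ab_group_add \<Rightarrow> 'a" +
  fixes C :: "'a set" and f :: "'a \<Rightarrow> 'a \<Rightarrow> complex"
  assumes subspace_C: "subspace C"
    and form_add_left: "\<lbrakk>x \<in> C; y \<in> C; z \<in> C\<rbrakk> \<Longrightarrow> f (x + y) z = f x z + f y z"
    and form_scl_left: "\<lbrakk>x \<in> C; y \<in> C\<rbrakk> \<Longrightarrow> f (scl c x) y = c * f x y"
    and form_commute: "\<lbrakk>x \<in> C; y \<in> C\<rbrakk> \<Longrightarrow> f x y = cnj (f y x)"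
    and form_nonneg: "x \<in> C \<Longrightarrow> 0 \<le> Re (f x x)"
begin

lemma in_C [simp]:
  "0 \<in> C"
  "x \<in> C \<Longrightarrow> y \<in> C \<Longrightarrow> x + y \<in> C"
  "x \<in> C \<Longrightarrow> scl c x \<in> C"
  "x \<in> C \<Longrightarrow> y \<in> C \<Longrightarrow> x - y \<in> C"
  using subspace_C by (auto intro: subspace_0 subspace_add subspace_scale subspace_diff)

lemma sum_in_C [simp]: "(\<And>k. k \<in> A \<Longrightarrow> e k \<in> C) \<Longrightarrow> sum e A \<in> C"
  using subspace_C by (rule subspace_sum)

lemma form_zero_left [simp]: "x \<in> C \<Longrightarrow> f 0 x = 0"
  using form_scl_left[of 0 x 0] by simp

lemma form_zero_right [simp]: "x \<in> C \<Longrightarrow> f x 0 = 0"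
  using form_commute[of x 0] by simp

lemma form_add_right: "\<lbrakk>x \<in> C; y \<in> C; z \<in> C\<rbrakk> \<Longrightarrow> f z (x + y) = f z x + f z y"
  by (metis complex_cnj_add form_add_left form_commute in_C(2))

lemma form_scl_right: "\<lbrakk>x \<in> C; y \<in> C\<rbrakk> \<Longrightarrow> f y (scl c x) = cnj c * f y x"
  by (metis complex_cnj_mult form_commute form_scl_left in_C(3))

lemma form_diff_left: "\<lbrakk>x \<in> C; y \<in> C; z \<in> C\<rbrakk> \<Longrightarrow> f (x - y) z = f x z - f y z"
  by (metis add_diff_cancel_right' diff_add_cancel form_add_left in_C(4))

lemma form_diff_right: "\<lbrakk>x \<in> C; y \<in> C; z \<in> C\<rbrakk> \<Longrightarrow> f z (x - y) = f z x - f z y"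
  by (metis add_diff_cancel_right' diff_add_cancel form_add_right in_C(4))

lemma combination_in_C [simp]:
  assumes "\<forall>k<N. e k \<in> C"
  shows "(\<Sum>k<N. scl (c k) (e k)) \<in> C"
  using assms by (intro sum_in_C in_C(3)) auto

lemma form_combination_left:
  fixes N :: nat
  assumes "\<forall>k<N. e k \<in> C" "y \<in> C"
  shows "f (\<Sum>k<N. scl (c k) (e k)) y = (\<Sum>k<N. c k * f (e k) y)"
  using assms by (induction N) (simp_all add: form_add_left form_scl_left)

lemma form_combination_right:
  fixes N :: nat
  assumes "\<forall>k<N. e k \<in> C" "y \<in> C"
  shows "f y (\<Sum>k<N. scl (c k) (e k)) = (\<Sum>k<N. cnj (c k) * f y (e k))"
  using assms by (induction N) (simp_all add: form_add_right form_scl_right)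

lemma form_self: "x \<in> C \<Longrightarrow> f x x = of_real (Re (f x x))"
  using form_commute[of x x] by (simp add: complex_eq_iff)

lemma Re_form_add:
  assumes "x \<in> C" "y \<in> C"
  shows "Re (f (x + y) (x + y)) = Re (f x x) + 2 * Re (f x y) + Re (f y y)"
  using assms form_commute[of y x] by (simp add: form_add_left form_add_right)

lemma Re_form_add_le:
  assumes "x \<in> C" "y \<in> C"
  shows "Re (f (x + y) (x + y)) \<le> 2 * Re (f x x) + 2 * Re (f y y)"
proof -
  have "0 \<le> Re (f (x - y) (x - y))"
    using assms by (simp add: form_nonneg)
  also have "\<dots> = Re (f x x) - 2 * Re (f x y) + Re (f y y)"
    using assms form_commute[of y x] by (simp add: form_diff_left form_diff_right)
  finally show ?thesis
    using assms by (simp add: Re_form_add)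
qed

lemma Im_form: "x \<in> C \<Longrightarrow> y \<in> C \<Longrightarrow> Im (f x y) = Re (f x (scl \<i> y))"
  by (simp add: form_scl_right)

text \<open>
  Zero entries are permitted: a sequence \<open>gram_schmidt d\<close> has one entry for each \<open>d n\<close>, and the entry
  is zero when \<open>d n\<close> lies, up to a null vector, in the span of its predecessors.
\<close>

definition orthonormal_below :: "(nat \<Rightarrow> 'a) \<Rightarrow> nat \<Rightarrow> bool" where
  "orthonormal_below e N \<longleftrightarrow>
     (\<forall>k<N. e k \<in> C \<and> (e k = 0 \<or> f (e k) (e k) = 1)) \<and>
     (\<forall>j<N. \<forall>k<N. j \<noteq> k \<longrightarrow> f (e j) (e k) = 0)"

definition residual :: "(nat \<Rightarrow> 'a) \<Rightarrow> nat \<Rightarrow> 'a \<Rightarrow> 'a" where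
  "residual e N x = x - (\<Sum>k<N. scl (f x (e k)) (e k))"

lemma residual_in_C [simp]: "orthonormal_below e N \<Longrightarrow> x \<in> C \<Longrightarrow> residual e N x \<in> C"
  unfolding residual_def orthonormal_below_def by (intro in_C(4) sum_in_C in_C(3)) auto

lemma form_combination:
  assumes "orthonormal_below e N" "j < N"
  shows "f (\<Sum>k<N. scl (c k) (e k)) (e j) = c j * f (e j) (e j)"
proof -
  have "f (\<Sum>k<N. scl (c k) (e k)) (e j) = (\<Sum>k<N. c k * f (e k) (e j))"
    using assms by (intro form_combination_left) (auto simp: orthonormal_below_def)
  also have "\<dots> = (\<Sum>k<N. if k = j then c j * f (e j) (e j) else 0)"
    using assms by (intro sum.cong) (auto simp: orthonormal_below_def)
  finally show ?thesis
    using assms by simp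
qed

lemma combination_bound:
  fixes c :: "nat \<Rightarrow> complex"
  assumes e: "orthonormal_below e N"
  defines "s \<equiv> (\<Sum>k<N. scl (c k) (e k))"
  shows "Re (f s s) \<le> (\<Sum>k<N. (cmod (c k))\<^sup>2)"
proof -
  have s: "s \<in> C"
    using e by (simp add: s_def orthonormal_below_def)
  have ek: "e k \<in> C" if "k < N" for k
    using e that by (simp add: orthonormal_below_def)
  have "f s s = (\<Sum>k<N. cnj (c k) * f s (e k))"
    using s ek by (subst (2) s_def) (simp add: form_combination_right)
  also have "\<dots> = (\<Sum>k<N. c k * cnj (c k) * f (e k) (e k))"
    using form_combination[OF e, of _ c, folded s_def] by (intro sum.cong) simp_all
  finally have "Re (f s s) = (\<Sum>k<N. Re (c k * cnj (c k) * f (e k) (e k)))"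
    by simp
  also have "\<dots> \<le> (\<Sum>k<N. (cmod (c k))\<^sup>2)"
  proof (rule sum_mono)
    fix k assume "k \<in> {..<N}"
    then have "e k = 0 \<or> f (e k) (e k) = 1"
      using e by (simp add: orthonormal_below_def)
    then show "Re (c k * cnj (c k) * f (e k) (e k)) \<le> (cmod (c k))\<^sup>2"
      using Re_mult_cnj_self[of "c k"] by auto
  qed
  finally show ?thesis .
qed

lemma form_residual_orthogonal:
  assumes e: "orthonormal_below e N" and x: "x \<in> C" and j: "j < N"
  shows "f (residual e N x) (e j) = 0"
proof -
  have ej: "e j \<in> C" "e j = 0 \<or> f (e j) (e j) = 1"
    using e j by (simp_all add: orthonormal_below_def)
  have s: "(\<Sum>k<N. scl (f x (e k)) (e k)) \<in> C"
    using e by (simp add: orthonormal_below_def)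
  show ?thesis
    using form_diff_left[OF x s ej(1)] form_combination[OF e j, of "\<lambda>k. f x (e k)"] ej x
    by (auto simp: residual_def)
qed

text \<open>
  Pythagoras: the residual is orthogonal to the subtracted combination. Bessel's inequality is the
  nonnegativity of the left-hand side.
\<close>

lemma Re_form_residual:
  assumes e: "orthonormal_below e N" and x: "x \<in> C"
  shows "Re (f (residual e N x) (residual e N x)) = Re (f x x) - (\<Sum>k<N. (cmod (f x (e k)))\<^sup>2)"
proof -
  let ?r = "residual e N x"
  define s where "s = (\<Sum>k<N. scl (f x (e k)) (e k))"
  have ek: "e k \<in> C" if "k < N" for k
    using e that by (simp add: orthonormal_below_def)
  have s: "s \<in> C"
    using ek by (simp add: s_def)
  have r: "?r = x - s" "?r \<in> C"
    using e x by (simp add: residual_def s_def, simp)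
  have "f ?r s = (\<Sum>k<N. cnj (f x (e k)) * f ?r (e k))"
    using r(2) ek by (simp add: s_def form_combination_right)
  then have "f ?r s = 0"
    using form_residual_orthogonal[OF e x] by simp
  then have "f ?r ?r = f x x - f s x"
    using r x s by (metis diff_zero form_diff_left form_diff_right)
  also have "f s x = (\<Sum>k<N. f x (e k) * cnj (f x (e k)))"
    using x ek form_commute[OF x] by (simp add: s_def form_combination_left)
  finally show ?thesis
    by (simp only: minus_complex.simps Re_sum Re_mult_cnj_self)
qed

lemma Re_form_residual_le:
  assumes "orthonormal_below e N" "x \<in> C"
  shows "Re (f (residual e N x) (residual e N x)) \<le> Re (f x x)"
  using Re_form_residual[OF assms] by (simp add: sum_nonneg)

lemma residual_add:
  assumes "orthonormal_below e N" "x \<in> C" "y \<in> C"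
  shows "residual e N (x + y) = residual e N x + residual e N y"
proof -
  have "(\<Sum>k<N. scl (f (x + y) (e k)) (e k)) =
      (\<Sum>k<N. scl (f x (e k)) (e k) + scl (f y (e k)) (e k))"
    using assms by (intro sum.cong)
      (auto simp: orthonormal_below_def form_add_left scale_left_distrib)
  then show ?thesis
    by (simp add: residual_def sum.distrib)
qed

text \<open>
  The convention \<open>1 / 0 = 0\<close> turns a residual \<open>u\<close> of seminorm zero into the zero vector, even when
  \<open>u\<close> itself is nonzero.
\<close>

fun gram_schmidt :: "(nat \<Rightarrow> 'a) \<Rightarrow> nat \<Rightarrow> 'a" where
  "gram_schmidt d n =
     (let u = d n - (\<Sum>k<n. scl (f (d n) (gram_schmidt d k)) (gram_schmidt d k))
      in scl (of_real (1 / sqrt (Re (f u u)))) u)"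

declare gram_schmidt.simps [simp del]

lemma gram_schmidt_residual:
  "gram_schmidt d n =
    scl (of_real (1 / sqrt (Re (f (residual (gram_schmidt d) n (d n))
      (residual (gram_schmidt d) n (d n))))))
      (residual (gram_schmidt d) n (d n))"
  by (subst gram_schmidt.simps) (simp add: residual_def Let_def)

lemma orthonormal_gram_schmidt:
  assumes d: "\<And>n. d n \<in> C"
  shows "orthonormal_below (gram_schmidt d) N"
proof (induction N)
  case 0
  then show ?case by (simp add: orthonormal_below_def)
next
  case (Suc N)
  let ?e = "gram_schmidt d"
  define u where "u = residual ?e N (d N)"
  define t where "t = sqrt (Re (f u u))"
  have u: "u \<in> C"
    using Suc d by (simp add: u_def)
  have eN: "?e N = scl (of_real (1 / t)) u"
    using gram_schmidt_residual[of d N] by (simp add: u_def t_def)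
  have tt: "f u u = of_real (t * t)"
    using form_self[OF u] form_nonneg[OF u] by (simp add: t_def)
  have norm: "?e N = 0 \<or> f (?e N) (?e N) = 1"
  proof (cases "t = 0")
    case True
    then show ?thesis by (simp add: eN)
  next
    case False
    then show ?thesis using u by (simp add: eN form_scl_left form_scl_right tt)
  qed
  have orth: "f (?e N) (?e j) = 0 \<and> f (?e j) (?e N) = 0" if "j < N" for j
  proof -
    have ej: "?e j \<in> C"
      using Suc that by (simp add: orthonormal_below_def)
    have "f u (?e j) = 0"
      using form_residual_orthogonal[OF Suc d that] by (simp add: u_def)
    then show ?thesis
      using u ej form_commute[of "?e j" u] by (simp add: eN form_scl_left form_scl_right)
  qed
  have "?e N \<in> C" using u by (simp add: eN)
  with Suc norm orth show ?case
    by (auto simp: orthonormal_below_def less_Suc_eq)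
qed

text \<open>
  By construction \<open>d n\<close> is, up to a null vector, a combination of the first \<open>n + 1\<close> entries. In terms of
  Pythagoras, entry \<open>n\<close> removes exactly the part \<open>Re (f u u)\<close> that is left over after the earlier ones,
  and later entries cannot make the residual larger.
\<close>

lemma gram_schmidt_exhausts:
  assumes d: "\<And>n. d n \<in> C" and N: "n < N"
  defines "e \<equiv> gram_schmidt d"
  shows "Re (f (residual e N (d n)) (residual e N (d n))) = 0"
proof -
  have e: "orthonormal_below e N" for N
    using orthonormal_gram_schmidt[OF d] by (simp add: e_def)
  then have eC: "e k \<in> C" for k
    unfolding orthonormal_below_def by blast
  define u where "u = residual e n (d n)"
  define t where "t = sqrt (Re (f u u))"
  have u: "u \<in> C"
    using e d by (simp add: u_def)
  have en: "e n = scl (of_real (1 / t)) u"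
    using gram_schmidt_residual[of d n] by (simp add: u_def t_def e_def)
  have tt: "f u u = of_real (t * t)"
    using form_self[OF u] form_nonneg[OF u] by (simp add: t_def)
  define s where "s = (\<Sum>k<n. scl (f (d n) (e k)) (e k))"
  have "s \<in> C" using eC by (simp add: s_def)
  moreover have "f s (e n) = 0"
    using e[of "Suc n"] eC by (simp add: s_def form_combination_left orthonormal_below_def)
  moreover have "d n = u + s"
    by (simp add: u_def residual_def s_def)
  ultimately have "f (d n) (e n) = f u (e n)"
    using u eC by (simp add: form_add_left)
  also have "\<dots> = of_real t"
    using u tt by (simp add: en form_scl_right)
  finally have "(cmod (f (d n) (e n)))\<^sup>2 = Re (f u u)"
    using tt by (simp add: power2_eq_square)
  then have zero: "Re (f (d n) (d n)) - (\<Sum>k<Suc n. (cmod (f (d n) (e k)))\<^sup>2) = 0"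
    using Re_form_residual[OF e d[of n], of n] by (simp add: u_def)
  have "(\<Sum>k<Suc n. (cmod (f (d n) (e k)))\<^sup>2) \<le> (\<Sum>k<N. (cmod (f (d n) (e k)))\<^sup>2)"
    using N by (intro sum_mono2) auto
  with zero have "Re (f (residual e N (d n)) (residual e N (d n))) \<le> 0"
    using Re_form_residual[OF e d[of n], of N] by simp
  moreover have "0 \<le> Re (f (residual e N (d n)) (residual e N (d n)))"
    using e d by (intro form_nonneg) simp
  ultimately show ?thesis by simp
qed

text \<open>
  Taking residuals is additive and does not increase the seminorm. Hence the residual of \<open>x\<close> is at most
  as large as that of \<open>d n\<close>, which is eventually null, plus the seminorm of \<open>x - d n\<close>, up to a factor
  \<open>2\<close>.
\<close>

lemma gram_schmidt_residual_tendsto: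
  assumes d: "\<And>n. d n \<in> C"
    and dense: "\<And>\<epsilon>. \<epsilon> > 0 \<Longrightarrow> \<exists>n. Re (f (x - d n) (x - d n)) < \<epsilon>"
    and x: "x \<in> C"
  defines "e \<equiv> gram_schmidt d"
  shows "(\<lambda>N. Re (f (residual e N x) (residual e N x))) \<longlonglongrightarrow> 0"
proof (rule LIMSEQ_I)
  have e: "orthonormal_below e N" for N
    using orthonormal_gram_schmidt[OF d] by (simp add: e_def)
  fix \<epsilon> :: real
  assume "\<epsilon> > 0"
  then obtain n where n: "Re (f (x - d n) (x - d n)) < \<epsilon> / 2"
    using dense[of "\<epsilon> / 2"] by auto
  have "norm (Re (f (residual e N x) (residual e N x)) - 0) < \<epsilon>" if "N \<ge> Suc n" for N
  proof -
    have "residual e N x = residual e N (x - d n) + residual e N (d n)"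
      using residual_add[OF e, of "x - d n" "d n" N] x d by simp
    then have "Re (f (residual e N x) (residual e N x)) \<le>
        2 * Re (f (residual e N (x - d n)) (residual e N (x - d n))) +
        2 * Re (f (residual e N (d n)) (residual e N (d n)))"
      using Re_form_add_le[of "residual e N (x - d n)" "residual e N (d n)"] e x d by simp
    also have "\<dots> \<le> 2 * Re (f (x - d n) (x - d n))"
      using gram_schmidt_exhausts[where d = d and n = n and N = N, OF d, folded e_def] Re_form_residual_le[OF e, of "x - d n" N] that x d
      by simp
    also have "\<dots> < \<epsilon>" using n by simp
    finally show ?thesis
      using form_nonneg[of "residual e N x"] e x by simp
  qed
  then show "\<exists>M. \<forall>N\<ge>M. norm (Re (f (residual e N x) (residual e N x)) - 0) < \<epsilon>" by blast
qed

end

interpretation ell2: semi_inner_product cscale UNIV cinner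
proof
  fix a b :: complex and x y z :: ell2
  show "cscale a (x + y) = cscale a x + cscale a y"
    "cscale (a + b) x = cscale a x + cscale b x"
    "cscale a (cscale b x) = cscale (a * b) x" "cscale 1 x = x"
    by (auto intro!: ell2_eqI simp: algebra_simps)
  show "module.subspace cscale (UNIV :: ell2 set)"
    by (subst module.subspace_def)
       (unfold_locales, auto intro!: ell2_eqI simp: algebra_simps)
  show "cinner (x + y) z = cinner x z + cinner y z"
    using sums_add[OF cinner_sums[of x z] cinner_sums[of y z]] cinner_sums[of "x + y" z]
    by (simp add: distrib_right sums_unique2)
  show "cinner (cscale a x) y = a * cinner x y"
    using sums_mult[OF cinner_sums[of x y], of a] cinner_sums[of "cscale a x" y]
    by (simp add: mult.assoc sums_unique2)
  show "cinner x y = cnj (cinner y x)"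
    using cinner_sums[of x y] sums_cnj[THEN iffD2, OF cinner_sums[of y x]]
    by (simp add: mult.commute sums_unique2)
  show "0 \<le> Re (cinner x x)"
    using inner_ge_zero[of x] by (simp add: inner_ell2_def)
qed

lemma Re_cinner_self: "Re (cinner x x) = (norm x)\<^sup>2"
  by (simp add: power2_norm_eq_inner inner_ell2_def)

text \<open>
  The Gram--Schmidt coefficients of \<open>x\<close> are the coordinates of its image. Since residuals tend to zero,
  Bessel's inequality becomes Parseval's equality, so the map preserves seminorms; polarization turns
  this into preservation of the forms.
\<close>

lemma (in semi_inner_product) isometry_into_ell2:
  assumes d: "\<And>n. d n \<in> C"
    and dense: "\<And>x \<epsilon>. x \<in> C \<Longrightarrow> \<epsilon> > 0 \<Longrightarrow> \<exists>n. Re (f (x - d n) (x - d n)) < \<epsilon>"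
  obtains \<Phi> where
    "\<And>x y. x \<in> C \<Longrightarrow> y \<in> C \<Longrightarrow> \<Phi> (x + y) = \<Phi> x + \<Phi> y"
    "\<And>c x. x \<in> C \<Longrightarrow> \<Phi> (scl c x) = cscale c (\<Phi> x)"
    "\<And>x y. x \<in> C \<Longrightarrow> y \<in> C \<Longrightarrow> cinner (\<Phi> x) (\<Phi> y) = f x y"
    "\<And>x k. x \<in> C \<Longrightarrow> coord (\<Phi> x) k = f x (gram_schmidt d k)"
proof -
  define e where "e = gram_schmidt d"
  have e: "orthonormal_below e N" for N
    using orthonormal_gram_schmidt[OF d] by (simp add: e_def)
  then have eC: "e k \<in> C" for k
    unfolding orthonormal_below_def by blast
  define \<Phi> where "\<Phi> x = of_coord (\<lambda>k. f x (e k))" for x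
  have parseval: "(\<lambda>k. (cmod (f x (e k)))\<^sup>2) sums Re (f x x)" if x: "x \<in> C" for x
  proof -
    have "(\<lambda>N. Re (f x x) - Re (f (residual e N x) (residual e N x))) \<longlonglongrightarrow> Re (f x x) - 0"
      unfolding e_def
      by (intro tendsto_diff tendsto_const gram_schmidt_residual_tendsto d dense x)
    then show ?thesis
      using Re_form_residual[OF e x] by (simp add: sums_def)
  qed
  have coord: "coord (\<Phi> x) = (\<lambda>k. f x (e k))" if "x \<in> C" for x
    using parseval[OF that] by (simp add: \<Phi>_def of_coord_inverse sums_iff)
  have add: "\<Phi> (x + y) = \<Phi> x + \<Phi> y" if "x \<in> C" "y \<in> C" for x y
    using that eC by (intro ell2_eqI) (simp add: coord form_add_left)
  have scl: "\<Phi> (scl c x) = cscale c (\<Phi> x)" if "x \<in> C" for c x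
    using that eC by (intro ell2_eqI) (simp add: coord form_scl_left)
  have norm: "Re (cinner (\<Phi> x) (\<Phi> x)) = Re (f x x)" if "x \<in> C" for x
    using norm_ell2_sums[of "\<Phi> x"] parseval[OF that] sums_unique2
    by (simp add: coord[OF that] Re_cinner_self)
  have Re: "Re (cinner (\<Phi> x) (\<Phi> y)) = Re (f x y)" if "x \<in> C" "y \<in> C" for x y
    using Re_form_add[OF that] ell2.Re_form_add[of "\<Phi> x" "\<Phi> y"] that
    by (simp add: norm flip: add)
  have inn: "cinner (\<Phi> x) (\<Phi> y) = f x y" if "x \<in> C" "y \<in> C" for x y
    using that Re[of x "scl \<i> y"]
    by (intro complex_eqI) (simp_all add: Re Im_form ell2.Im_form flip: scl)
  show thesis
    by (rule that[OF add scl inn]) (simp_all add: coord e_def)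
qed

section \<open>Operators on square-summable sequences\<close>

lemma norm_cscale: "norm (cscale c x) = cmod c * norm x"
proof -
  have "(norm (cscale c x))\<^sup>2 = Re (c * cnj c * cinner x x)"
    by (simp add: ell2.form_scl_left ell2.form_scl_right algebra_simps flip: Re_cinner_self)
  also have "\<dots> = (cmod c * norm x)\<^sup>2"
    unfolding power_mult_distrib cmod_power2
    by (subst ell2.form_self) (simp_all add: Re_cinner_self power2_eq_square)
  finally show ?thesis
    by simp
qed

lemma scaleR_ell2_eq: "r *\<^sub>R x = cscale (of_real r) (x :: ell2)"
  by (rule ell2_eqI) simp

lemma cmod_cinner_le: "cmod (cinner x y) \<le> norm x * norm y"
proof (cases "cinner x y = 0")
  case False
  define c where "c = cnj (cinner x y) / of_real (cmod (cinner x y))"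
  have "cmod c = 1"
    using False by (simp add: c_def norm_divide)
  have "c * cinner x y = of_real (cmod (cinner x y))"
    using False complex_norm_square[of "cinner x y"]
    by (simp add: c_def power2_eq_square mult.commute field_simps)
  then have "cmod (cinner x y) = inner (cscale c x) y"
    by (simp add: inner_ell2_def ell2.form_scl_left)
  also have "\<dots> \<le> norm (cscale c x) * norm y"
    by (rule norm_cauchy_schwarz)
  finally show ?thesis
    using \<open>cmod c = 1\<close> by (simp add: norm_cscale)
qed simp

lemma cinner_ext: "(\<And>z. cinner z x = cinner z y) \<Longrightarrow> x = y"
  using Re_cinner_self[of "x - y"] ell2.form_diff_right[of x y "x - y"] by simp

lift_definition unit_vec :: "nat \<Rightarrow> ell2" is "\<lambda>n k. if k = n then 1 else 0"
  by (rule summable_finite[of "{_}"]) auto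

lemma coord_unit_vec: "coord (unit_vec n) k = (if k = n then 1 else 0)"
  by (simp add: unit_vec.rep_eq)

lemma cinner_unit_vec [simp]: "cinner x (unit_vec n) = coord x n"
proof -
  have "(\<lambda>k. coord x k * cnj (coord (unit_vec n) k)) = (\<lambda>k. if k = n then coord x k else 0)"
    by (auto simp: coord_unit_vec)
  then show ?thesis
    using cinner_sums[of x "unit_vec n"] sums_single[of n "coord x"] sums_unique2 by metis
qed

lemma orthonormal_unit_vec: "ell2.orthonormal_below unit_vec N"
  by (simp add: ell2.orthonormal_below_def coord_unit_vec)

lemma norm_unit_vec [simp]: "norm (unit_vec n) = 1"
  using Re_cinner_self[of "unit_vec n"] norm_ge_zero[of "unit_vec n"]
  by (simp add: coord_unit_vec power2_eq_1_iff)

lemma norm_unit_combination_le: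
  "(norm (\<Sum>k<N. cscale (c k) (unit_vec k)))\<^sup>2 \<le> (\<Sum>k<N. (cmod (c k))\<^sup>2)"
  using ell2.combination_bound[OF orthonormal_unit_vec] by (simp add: Re_cinner_self)

lemma unit_vec_expansion: "(\<lambda>k. cscale (coord x k) (unit_vec k)) sums x"
proof -
  have "(\<lambda>N. (norm x)\<^sup>2 - (\<Sum>k<N. (cmod (coord x k))\<^sup>2)) \<longlonglongrightarrow> (norm x)\<^sup>2 - (norm x)\<^sup>2"
    using norm_ell2_sums[of x] unfolding sums_def by (intro tendsto_intros)
  then have "(\<lambda>N. (norm (x - (\<Sum>k<N. cscale (coord x k) (unit_vec k))))\<^sup>2) \<longlonglongrightarrow> 0"
    using ell2.Re_form_residual[OF orthonormal_unit_vec, of x]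
    by (simp add: Re_cinner_self ell2.residual_def)
  then have "(\<lambda>N. norm (x - (\<Sum>k<N. cscale (coord x k) (unit_vec k)))) \<longlonglongrightarrow> 0"
    using tendsto_real_sqrt by fastforce
  then have "(\<lambda>N. x - (\<Sum>k<N. cscale (coord x k) (unit_vec k))) \<longlonglongrightarrow> 0"
    by (rule tendsto_norm_zero_cancel)
  from tendsto_diff[OF tendsto_const[of x] this] show ?thesis
    unfolding sums_def by simp
qed

lemma rational_complex_near:
  assumes "\<epsilon> > 0"
  shows "\<exists>q :: rat \<times> rat. cmod (z - Complex (of_rat (fst q)) (of_rat (snd q))) < \<epsilon>"
proof -
  obtain a where a: "Re z < of_rat a" "of_rat a < Re z + \<epsilon> / 2"
    using of_rat_dense[of "Re z" "Re z + \<epsilon> / 2"] assms by auto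
  obtain b where b: "Im z < of_rat b" "of_rat b < Im z + \<epsilon> / 2"
    using of_rat_dense[of "Im z" "Im z + \<epsilon> / 2"] assms by auto
  have "cmod (z - Complex (of_rat a) (of_rat b)) \<le> \<bar>Re z - of_rat a\<bar> + \<bar>Im z - of_rat b\<bar>"
    using cmod_le[of "z - Complex (of_rat a) (of_rat b)"] by simp
  also have "\<dots> < \<epsilon>" using a b by simp
  finally have "cmod (z - Complex (of_rat (fst (a, b))) (of_rat (snd (a, b)))) < \<epsilon>" by simp
  then show ?thesis by blast
qed

text \<open>
  Finite sequences of rational complex numbers form a countable dense set.
\<close>

lemma ell2_dense_sequence:
  obtains d :: "nat \<Rightarrow> ell2" where "\<And>x \<epsilon>. \<epsilon> > 0 \<Longrightarrow> \<exists>n. norm (x - d n) < \<epsilon>"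
proof -
  define v :: "(rat \<times> rat) list \<Rightarrow> ell2" where
    "v l = (\<Sum>k<length l. cscale (Complex (of_rat (fst (l ! k))) (of_rat (snd (l ! k)))) (unit_vec k))" for l
  have "\<exists>n. norm (x - v (from_nat n)) < \<epsilon>" if "\<epsilon> > 0" for x :: ell2 and \<epsilon> :: real
  proof -
    obtain N where N: "norm ((\<Sum>k<N. cscale (coord x k) (unit_vec k)) - x) < \<epsilon> / 2"
      using unit_vec_expansion[of x] \<open>\<epsilon> > 0\<close> unfolding sums_def LIMSEQ_iff
      by (meson half_gt_zero order_refl)
    define \<delta> where "\<delta> = \<epsilon> / (2 * (N + 1))"
    have \<delta>: "\<delta> > 0" "N * \<delta> \<le> \<epsilon> / 2"
      using \<open>\<epsilon> > 0\<close> by (simp_all add: \<delta>_def field_simps)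
    have "\<forall>k. \<exists>q :: rat \<times> rat. cmod (coord x k - Complex (of_rat (fst q)) (of_rat (snd q))) < \<delta>"
      using rational_complex_near[OF \<delta>(1)] by blast
    from choice[OF this] obtain q :: "nat \<Rightarrow> rat \<times> rat" where
      q: "\<And>k. cmod (coord x k - Complex (of_rat (fst (q k))) (of_rat (snd (q k)))) < \<delta>"
      by blast
    define l where "l = map q [0..<N]"
    have "v l = (\<Sum>k<N. cscale (Complex (of_rat (fst (q k))) (of_rat (snd (q k)))) (unit_vec k))"
      by (simp add: v_def l_def)
    then have "norm ((\<Sum>k<N. cscale (coord x k) (unit_vec k)) - v l) =
        norm (\<Sum>k<N. cscale (coord x k - Complex (of_rat (fst (q k))) (of_rat (snd (q k)))) (unit_vec k))"
      by (simp add: ell2.scale_left_diff_distrib sum_subtractf)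
    also have "\<dots> \<le> (\<Sum>k<N. \<delta>)"
      by (rule sum_norm_le) (simp add: norm_cscale less_imp_le q)
    also have "\<dots> \<le> \<epsilon> / 2" using \<delta> by simp
    finally have "norm ((\<Sum>k<N. cscale (coord x k) (unit_vec k)) - v l) \<le> \<epsilon> / 2" .
    then have "norm (x - v l) < \<epsilon>"
      using N norm_triangle_ineq4[of "(\<Sum>k<N. cscale (coord x k) (unit_vec k)) - v l"
          "(\<Sum>k<N. cscale (coord x k) (unit_vec k)) - x"] by simp
    then show ?thesis
      by (metis from_nat_to_nat)
  qed
  then show thesis by (rule that)
qed

definition clinear_op :: "(ell2 \<Rightarrow> ell2) \<Rightarrow> bool" where
  "clinear_op T \<longleftrightarrow> (\<forall>x y. T (x + y) = T x + T y) \<and> (\<forall>c x. T (cscale c x) = cscale c (T x))"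

definition contractive :: "(ell2 \<Rightarrow> ell2) \<Rightarrow> bool" where
  "contractive T \<longleftrightarrow> clinear_op T \<and> (\<forall>x. norm (T x) \<le> norm x)"

lemma clinear_op_zero: "clinear_op T \<Longrightarrow> T 0 = 0"
  unfolding clinear_op_def by (metis add_cancel_right_right)

lemma clinear_op_diff: "clinear_op T \<Longrightarrow> T (x - y) = T x - T y"
  unfolding clinear_op_def by (metis add_diff_cancel_right' diff_add_cancel)

lemma clinear_op_combination:
  "clinear_op T \<Longrightarrow> T (\<Sum>k<N::nat. cscale (c k) (x k)) = (\<Sum>k<N. cscale (c k) (T (x k)))"
  by (induction N) (simp_all add: clinear_op_zero, simp add: clinear_op_def)

lemma contractive_bounded_linear: "contractive T \<Longrightarrow> bounded_linear T"
  by (rule bounded_linear_intro[of _ 1])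
     (simp_all add: contractive_def clinear_op_def scaleR_ell2_eq)

text \<open>
  The condition that \<open>unit_vec k \<mapsto> w k\<close> extends to a contraction, phrased for finite combinations.
\<close>

definition bessel :: "(nat \<Rightarrow> ell2) \<Rightarrow> bool" where
  "bessel w \<longleftrightarrow> (\<forall>N c. (norm (\<Sum>k<N. cscale (c k) (w k)))\<^sup>2 \<le> (\<Sum>k<N. (cmod (c k))\<^sup>2))"

text \<open>
  With \<open>P\<close> the sum of the first \<open>N\<close> squared coefficients of \<open>y\<close> and \<open>v\<close> the corresponding
  combination of the \<open>w k\<close>, one has \<open>P = \<langle>y, v\<rangle>\<close> and \<open>\<parallel>v\<parallel>\<^sup>2 \<le> P\<close>. Cauchy--Schwarz therefore
  gives \<open>P\<^sup>2 \<le> \<parallel>y\<parallel>\<^sup>2 P\<close>, that is, \<open>P \<le> \<parallel>y\<parallel>\<^sup>2\<close>.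
\<close>

lemma bessel_analysis:
  assumes "bessel w"
  obtains S where "contractive S" "\<And>y n. coord (S y) n = cinner y (w n)"
proof -
  have bound: "(\<Sum>k<N. (cmod (cinner y (w k)))\<^sup>2) \<le> (norm y)\<^sup>2" for N y
  proof -
    define P where "P = (\<Sum>k<N. (cmod (cinner y (w k)))\<^sup>2)"
    define v where "v = (\<Sum>k<N. cscale (cinner y (w k)) (w k))"
    have "Re (cinner y v) = (\<Sum>k<N. Re (cinner y (w k) * cnj (cinner y (w k))))"
      by (simp add: v_def ell2.form_combination_right mult.commute)
    then have "P = inner y v"
      by (simp only: inner_ell2_def P_def Re_mult_cnj_self)
    also have "\<dots> \<le> norm y * norm v"
      by (rule norm_cauchy_schwarz)
    finally have "P\<^sup>2 \<le> (norm y * norm v)\<^sup>2"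
      by (rule power_mono) (simp add: P_def sum_nonneg)
    also have "\<dots> \<le> (norm y)\<^sup>2 * P"
      using assms unfolding bessel_def P_def v_def power_mult_distrib
      by (intro mult_left_mono) auto
    finally have "P * P \<le> (norm y)\<^sup>2 * P"
      by (simp add: power2_eq_square)
    moreover have "P \<ge> 0" by (simp add: P_def sum_nonneg)
    ultimately show ?thesis
      unfolding P_def[symmetric] by (cases "P = 0") auto
  qed
  have "\<exists>x. coord x = (\<lambda>n. cinner y (w n)) \<and> norm x \<le> norm y" for y
    using ell2_of_bounded_sums[OF bound[where y = y]] by (metis norm_ge_zero)
  then obtain S where S: "\<And>y. coord (S y) = (\<lambda>n. cinner y (w n))" "\<And>y. norm (S y) \<le> norm y"
    by metis
  have "contractive S"
    unfolding contractive_def clinear_op_def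
    by (auto intro!: ell2_eqI simp: S ell2.form_add_left ell2.form_scl_left)
  with S(1) show thesis by (intro that[of S]) simp_all
qed

text \<open>
  The adjoint must send \<open>y\<close> to the sequence of its inner products with the images of the unit vectors,
  which is an analysis operator.
\<close>

lemma contractive_adjoint:
  assumes B: "contractive B"
  obtains B' where "contractive B'" "\<And>x y. cinner (B x) y = cinner x (B' y)"
proof -
  have "bessel (\<lambda>n. B (unit_vec n))"
    unfolding bessel_def
  proof (intro allI)
    fix N :: nat and c :: "nat \<Rightarrow> complex"
    have "(norm (\<Sum>k<N. cscale (c k) (B (unit_vec k))))\<^sup>2 =
        (norm (B (\<Sum>k<N. cscale (c k) (unit_vec k))))\<^sup>2"
      using B by (simp add: contractive_def clinear_op_combination)
    also have "\<dots> \<le> (norm (\<Sum>k<N. cscale (c k) (unit_vec k)))\<^sup>2"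
      using B by (simp add: contractive_def power_mono)
    also have "\<dots> \<le> (\<Sum>k<N. (cmod (c k))\<^sup>2)"
      by (rule norm_unit_combination_le)
    finally show "(norm (\<Sum>k<N. cscale (c k) (B (unit_vec k))))\<^sup>2 \<le> (\<Sum>k<N. (cmod (c k))\<^sup>2)" .
  qed
  then obtain B' where B': "contractive B'" "\<And>y n. coord (B' y) n = cinner y (B (unit_vec n))"
    using bessel_analysis by metis
  have "cinner (B x) y = cinner x (B' y)" for x y
  proof -
    have "bounded_linear (\<lambda>x. cinner x y)"
      by (rule bounded_linear_intro[of _ "norm y"])
         (simp_all add: ell2.form_add_left ell2.form_scl_left scaleR_ell2_eq cmod_cinner_le scaleR_conv_of_real)
    then have "bounded_linear (\<lambda>x. cinner (B x) y)"
      using bounded_linear_compose contractive_bounded_linear[OF B] by blast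
    from bounded_linear.sums[OF this unit_vec_expansion[of x]]
    have "(\<lambda>k. coord x k * cinner (B (unit_vec k)) y) sums cinner (B x) y"
      using B by (simp add: contractive_def clinear_op_def ell2.form_scl_left)
    moreover have "cinner (B (unit_vec k)) y = cnj (coord (B' y) k)" for k
      using B'(2) by (simp add: ell2.form_commute[of y])
    ultimately show ?thesis
      using cinner_sums[of x "B' y"] sums_unique2 by fastforce
  qed
  with B'(1) show thesis by (rule that)
qed

text \<open>
  The extension of \<open>unit_vec k \<mapsto> w k\<close> is the adjoint of the analysis operator of \<open>w\<close>.
\<close>

lemma bessel_synthesis:
  assumes "bessel w"
  obtains W where "contractive W" "\<And>n. W (unit_vec n) = w n"
proof -
  obtain S where S: "contractive S" "\<And>y n. coord (S y) n = cinner y (w n)"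
    using bessel_analysis[OF assms] by metis
  obtain W where W: "contractive W" "\<And>x y. cinner (S x) y = cinner x (W y)"
    using contractive_adjoint[OF S(1)] by metis
  have "W (unit_vec n) = w n" for n
    by (rule cinner_ext) (simp add: S(2) flip: W(2))
  with W(1) show thesis by (rule that)
qed

text \<open>
  Interleaving identifies \<open>\<ell>\<^sup>2 \<oplus> \<ell>\<^sup>2\<close> with \<open>\<ell>\<^sup>2\<close>, so orthogonal direct sums stay within one type. The
  first summand occupies the even coordinates.
\<close>

lift_definition join :: "ell2 \<Rightarrow> ell2 \<Rightarrow> ell2" is
  "\<lambda>x y n. if even n then x (n div 2) else y ((n - 1) div 2)"
proof -
  fix x y :: "nat \<Rightarrow> complex"
  assume "summable (\<lambda>n. (cmod (x n))\<^sup>2)" "summable (\<lambda>n. (cmod (y n))\<^sup>2)"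
  from sums_if[OF summable_sums[OF this(2)] summable_sums[OF this(1)]]
  have "summable (\<lambda>n. if even n then (cmod (x (n div 2)))\<^sup>2 else (cmod (y ((n - 1) div 2)))\<^sup>2)"
    by (rule sums_summable)
  then show "summable (\<lambda>n. (cmod (if even n then x (n div 2) else y ((n - 1) div 2)))\<^sup>2)"
    by (rule back_subst[of summable]) auto
qed

lift_definition left_part :: "ell2 \<Rightarrow> ell2" is "\<lambda>x n. x (2 * n)"
  using summable_reindex[of "\<lambda>n. (cmod (_ n))\<^sup>2" "\<lambda>n. 2 * n"] by (simp add: o_def inj_def)

lift_definition right_part :: "ell2 \<Rightarrow> ell2" is "\<lambda>x n. x (2 * n + 1)"
  using summable_reindex[of "\<lambda>n. (cmod (_ n))\<^sup>2" "\<lambda>n. 2 * n + 1"] by (simp add: o_def inj_def)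

lemma join_simps [simp]:
  "left_part (join x y) = x" "right_part (join x y) = y" "join (left_part z) (right_part z) = z"
  by (rule ell2_eqI; simp add: join.rep_eq left_part.rep_eq right_part.rep_eq)+

lemma join_linear:
  "join (x + x') (y + y') = join x y + join x' y'"
  "cscale c (join x y) = join (cscale c x) (cscale c y)"
  "left_part (z + z') = left_part z + left_part z'"
  "right_part (z + z') = right_part z + right_part z'"
  "left_part (cscale c z) = cscale c (left_part z)"
  "right_part (cscale c z) = cscale c (right_part z)"
  by (rule ell2_eqI; simp add: join.rep_eq left_part.rep_eq right_part.rep_eq)+

lemma cinner_join: "cinner (join a b) (join c d) = cinner a c + cinner b d"
proof -
  have eq: "coord (join a b) n * cnj (coord (join c d) n) =
      (if even n then coord a (n div 2) * cnj (coord c (n div 2))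
       else coord b ((n - 1) div 2) * cnj (coord d ((n - 1) div 2)))" for n
    by (simp add: join.rep_eq)
  have re: "(\<lambda>n. Re (coord (join a b) n * cnj (coord (join c d) n))) sums (Re (cinner b d) + Re (cinner a c))"
    unfolding eq if_distrib[of Re] by (intro sums_if sums_Re cinner_sums)
  have im: "(\<lambda>n. Im (coord (join a b) n * cnj (coord (join c d) n))) sums (Im (cinner b d) + Im (cinner a c))"
    unfolding eq if_distrib[of Im] by (intro sums_if sums_Im cinner_sums)
  show ?thesis
    using sums_unique2[OF sums_Re[OF cinner_sums] re] sums_unique2[OF sums_Im[OF cinner_sums] im]
    by (simp add: complex_eq_iff)
qed

lemma norm_join: "(norm (join x y))\<^sup>2 = (norm x)\<^sup>2 + (norm y)\<^sup>2"
  by (simp add: cinner_join flip: Re_cinner_self)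

section \<open>Transferring contractions to square-summable sequences\<close>

definition (in semi_inner_product) contractive_on :: "('a \<Rightarrow> 'a) \<Rightarrow> bool" where
  "contractive_on T \<longleftrightarrow> (\<forall>x\<in>C. T x \<in> C) \<and> (\<forall>x\<in>C. \<forall>y\<in>C. T (x + y) = T x + T y) \<and>
     (\<forall>c. \<forall>x\<in>C. T (scl c x) = scl c (T x)) \<and> (\<forall>x\<in>C. Re (f (T x) (T x)) \<le> Re (f x x))"

text \<open>
  The image of \<open>\<Phi>\<close> may be a proper subspace of \<open>\<ell>\<^sup>2\<close>, so transporting \<open>T\<close> along \<open>\<Phi>\<close> has to be
  accompanied by an extension to all of \<open>\<ell>\<^sup>2\<close>. The unit vector \<open>unit_vec k\<close> is sent to the image of
  \<open>T (e k)\<close>, where \<open>e\<close> is the Gram--Schmidt sequence: since \<open>e\<close> is orthonormal up to zeros and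
  \<open>T\<close> is contractive, these vectors form a Bessel sequence. One isometry \<open>\<Phi>\<close> serves all contractions.
\<close>

lemma (in semi_inner_product) isometry_extending_contractions:
  fixes d :: "nat \<Rightarrow> 'a"
  assumes d: "\<And>n. d n \<in> C"
    and dense: "\<And>x \<epsilon>. x \<in> C \<Longrightarrow> \<epsilon> > 0 \<Longrightarrow> \<exists>n. Re (f (x - d n) (x - d n)) < \<epsilon>"
  obtains \<Phi> where
    "\<And>x y. x \<in> C \<Longrightarrow> y \<in> C \<Longrightarrow> \<Phi> (x + y) = \<Phi> x + \<Phi> y"
    "\<And>c x. x \<in> C \<Longrightarrow> \<Phi> (scl c x) = cscale c (\<Phi> x)"
    "\<And>x y. x \<in> C \<Longrightarrow> y \<in> C \<Longrightarrow> cinner (\<Phi> x) (\<Phi> y) = f x y"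
    "\<And>T. contractive_on T \<Longrightarrow> \<exists>S. contractive S \<and> (\<forall>x\<in>C. S (\<Phi> x) = \<Phi> (T x))"
proof -
  obtain \<Phi> where add: "\<And>x y. x \<in> C \<Longrightarrow> y \<in> C \<Longrightarrow> \<Phi> (x + y) = \<Phi> x + \<Phi> y"
    and scl: "\<And>c x. x \<in> C \<Longrightarrow> \<Phi> (scl c x) = cscale c (\<Phi> x)"
    and inn: "\<And>x y. x \<in> C \<Longrightarrow> y \<in> C \<Longrightarrow> cinner (\<Phi> x) (\<Phi> y) = f x y"
    and coord: "\<And>x k. x \<in> C \<Longrightarrow> coord (\<Phi> x) k = f x (gram_schmidt d k)"
    by (rule isometry_into_ell2[of d]) (use d dense in auto)
  define e where "e = gram_schmidt d"
  have e: "orthonormal_below e N" for N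
    using orthonormal_gram_schmidt[OF d] by (simp add: e_def)
  then have eC: "e k \<in> C" for k
    unfolding orthonormal_below_def by blast
  have extend: "\<exists>S. contractive S \<and> (\<forall>x\<in>C. S (\<Phi> x) = \<Phi> (T x))"
    if T: "contractive_on T" for T
  proof -
    have TC: "T x \<in> C" and Tadd: "y \<in> C \<Longrightarrow> T (x + y) = T x + T y"
      and Tscl: "T (scl c x) = scl c (T x)" and Tle: "Re (f (T x) (T x)) \<le> Re (f x x)"
      if "x \<in> C" for x y c
      using T that by (simp_all add: contractive_on_def)
    define \<Psi> where "\<Psi> x = \<Phi> (T x)" for x
    have \<Psi>_add: "\<Psi> (x + y) = \<Psi> x + \<Psi> y" if "x \<in> C" "y \<in> C" for x y
      using that TC by (simp add: \<Psi>_def Tadd add)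
    have \<Psi>_scl: "\<Psi> (scl c x) = cscale c (\<Psi> x)" if "x \<in> C" for c x
      using that TC by (simp add: \<Psi>_def Tscl scl)
    have \<Psi>_le: "(norm (\<Psi> x))\<^sup>2 \<le> Re (f x x)" if "x \<in> C" for x
      using that TC Tle by (simp add: \<Psi>_def inn flip: Re_cinner_self)
    have "\<Psi> 0 = 0"
      using \<Psi>_scl[of 0 0] by (simp add: ell2_eqI)
    then have \<Psi>_combination: "\<Psi> (\<Sum>k<N. scl (c k) (e k)) = (\<Sum>k<N. cscale (c k) (\<Psi> (e k)))"
      for c and N :: nat
      using eC by (induction N) (simp_all add: \<Psi>_add \<Psi>_scl)
    have "bessel (\<lambda>k. \<Psi> (e k))"
      unfolding bessel_def
    proof (intro allI)
      fix N :: nat and c :: "nat \<Rightarrow> complex"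
      have "(norm (\<Sum>k<N. cscale (c k) (\<Psi> (e k))))\<^sup>2
          \<le> Re (f (\<Sum>k<N. scl (c k) (e k)) (\<Sum>k<N. scl (c k) (e k)))"
        using \<Psi>_le[of "\<Sum>k<N. scl (c k) (e k)"] eC by (simp add: \<Psi>_combination)
      also have "\<dots> \<le> (\<Sum>k<N. (cmod (c k))\<^sup>2)"
        by (rule combination_bound[OF e])
      finally show "(norm (\<Sum>k<N. cscale (c k) (\<Psi> (e k))))\<^sup>2 \<le> (\<Sum>k<N. (cmod (c k))\<^sup>2)" .
    qed
    then obtain S where S: "contractive S" "\<And>k. S (unit_vec k) = \<Psi> (e k)"
      using bessel_synthesis by metis
    \<comment> \<open>Both sides are the sum of one series: the left one by continuity of \<open>S\<close>, the right one because
      \<open>\<Psi>\<close> maps residuals to a null sequence.\<close>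
    have "S (\<Phi> x) = \<Psi> x" if x: "x \<in> C" for x
    proof -
      have "(\<lambda>k. S (cscale (coord (\<Phi> x) k) (unit_vec k))) sums S (\<Phi> x)"
        using bounded_linear.sums[OF contractive_bounded_linear[OF S(1)] unit_vec_expansion] .
      then have "(\<lambda>k. cscale (f x (e k)) (\<Psi> (e k))) sums S (\<Phi> x)"
        using S x by (simp add: contractive_def clinear_op_def coord e_def)
      moreover have "(\<lambda>k. cscale (f x (e k)) (\<Psi> (e k))) sums \<Psi> x"
      proof -
        have split: "\<Psi> x = \<Psi> (residual e N x) + (\<Sum>k<N. cscale (f x (e k)) (\<Psi> (e k)))" for N
        proof -
          have "\<Psi> x = \<Psi> (residual e N x + (\<Sum>k<N. scl (f x (e k)) (e k)))"
            by (simp add: residual_def)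
          also have "\<dots> = \<Psi> (residual e N x) + \<Psi> (\<Sum>k<N. scl (f x (e k)) (e k))"
            using e x eC by (intro \<Psi>_add) simp_all
          finally show ?thesis
            by (simp only: \<Psi>_combination)
        qed
        have "(\<lambda>N. Re (f (residual e N x) (residual e N x))) \<longlonglongrightarrow> 0"
          unfolding e_def by (intro gram_schmidt_residual_tendsto d dense x)
        then have "(\<lambda>N. (norm (\<Psi> (residual e N x)))\<^sup>2) \<longlonglongrightarrow> 0"
        proof (rule tendsto_sandwich[OF _ _ tendsto_const, rotated 2])
          show "\<forall>\<^sub>F N in sequentially. 0 \<le> (norm (\<Psi> (residual e N x)))\<^sup>2" by simp
          show "\<forall>\<^sub>F N in sequentially.
              (norm (\<Psi> (residual e N x)))\<^sup>2 \<le> Re (f (residual e N x) (residual e N x))"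
            using e x by (intro always_eventually allI \<Psi>_le residual_in_C)
        qed
        then have "(\<lambda>N. norm (\<Psi> (residual e N x))) \<longlonglongrightarrow> 0"
          using tendsto_real_sqrt by fastforce
        then have "(\<lambda>N. \<Psi> (residual e N x)) \<longlonglongrightarrow> 0"
          by (rule tendsto_norm_zero_cancel)
        from tendsto_diff[OF tendsto_const[of "\<Psi> x"] this]
        have "(\<lambda>N. \<Psi> x - \<Psi> (residual e N x)) \<longlonglongrightarrow> \<Psi> x"
          by simp
        moreover have "\<Psi> x - \<Psi> (residual e N x) = (\<Sum>k<N. cscale (f x (e k)) (\<Psi> (e k)))" for N
          using split[of N] by (metis add_diff_cancel_left')
        ultimately show ?thesis
          by (simp add: sums_def)
      qed
      ultimately show ?thesis by (rule sums_unique2)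
    qed
    with S(1) show ?thesis by (auto simp: \<Psi>_def)
  qed
  show thesis
    by (rule that[OF add scl inn extend])
qed

section \<open>The unitary dilation of a contraction on square-summable sequences\<close>

definition isometric :: "(ell2 \<Rightarrow> ell2) \<Rightarrow> bool" where
  "isometric V \<longleftrightarrow> clinear_op V \<and> (\<forall>x y. cinner (V x) (V y) = cinner x y)"

definition unitary_op :: "(ell2 \<Rightarrow> ell2) \<Rightarrow> (ell2 \<Rightarrow> ell2) \<Rightarrow> bool" where
  "unitary_op U U' \<longleftrightarrow> clinear_op U \<and> clinear_op U' \<and>
     (\<forall>x y. cinner (U x) y = cinner x (U' y)) \<and> (\<forall>x. U' (U x) = x) \<and> (\<forall>x. U (U' x) = x)"

lemma isometric_contractive: "isometric V \<Longrightarrow> contractive V"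
  unfolding contractive_def isometric_def
  by (metis Re_cinner_self norm_ge_zero order_refl power2_eq_imp_eq)

text \<open>
  Let \<open>D\<close> be an isometry into \<open>\<ell>\<^sup>2\<close> for the form \<open>\<langle>z, w\<rangle> - \<langle>S z\<^sub>1, S w\<^sub>1\<rangle>\<close> on
  \<open>\<ell>\<^sup>2 \<oplus> \<ell>\<^sup>2\<close>, where the index \<open>1\<close> marks the first component. Then \<open>z \<mapsto> (S z\<^sub>1, D z)\<close> preserves inner
  products. The map \<open>D\<close> does the work of the defect operator \<open>(1 - S\<^sup>* S)\<^sup>1\<^sup>/\<^sup>2\<close> together with a
  shift, and no square root of a positive operator has to be taken.
\<close>

lemma isometric_dilation:
  assumes S: "contractive S"
  obtains V where "isometric V" "\<And>z. left_part (V z) = S (left_part z)"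
proof -
  define g where "g z w = cinner z w - cinner (S (left_part z)) (S (left_part w))" for z w
  have g_self: "Re (g z z) = (norm z)\<^sup>2 - (norm (S (left_part z)))\<^sup>2" for z
    by (simp add: g_def Re_cinner_self)
  have left_le: "(norm (S (left_part z)))\<^sup>2 \<le> (norm z)\<^sup>2" for z
  proof -
    have "(norm (S (left_part z)))\<^sup>2 \<le> (norm (left_part z))\<^sup>2"
      using S by (simp add: contractive_def power_mono)
    also have "\<dots> \<le> (norm z)\<^sup>2"
      using norm_join[of "left_part z" "right_part z"] by simp
    finally show ?thesis .
  qed
  interpret g: semi_inner_product cscale UNIV g
  proof
    fix a :: complex and x y z :: ell2
    show "ell2.subspace UNIV" by (rule ell2.subspace_C)
    show "g (x + y) z = g x z + g y z" "g (cscale a x) y = a * g x y"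
      using S by (simp_all add: g_def contractive_def clinear_op_def join_linear
          ell2.form_add_left ell2.form_scl_left algebra_simps)
    show "g x y = cnj (g y x)"
      unfolding g_def complex_cnj_diff by (intro arg_cong2[where f = minus] ell2.form_commute) auto
    show "0 \<le> Re (g x x)"
      using left_le by (simp add: g_self)
  qed
  obtain d :: "nat \<Rightarrow> ell2" where d: "\<And>x \<epsilon>. \<epsilon> > 0 \<Longrightarrow> \<exists>n. norm (x - d n) < \<epsilon>"
    using ell2_dense_sequence by metis
  have dense: "\<exists>n. Re (g (x - d n) (x - d n)) < \<epsilon>" if "\<epsilon> > 0" for x \<epsilon>
  proof -
    obtain n where "norm (x - d n) < sqrt \<epsilon>"
      using d[of "sqrt \<epsilon>" x] \<open>\<epsilon> > 0\<close> by auto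
    then have "(norm (x - d n))\<^sup>2 < (sqrt \<epsilon>)\<^sup>2"
      by (intro power_strict_mono) auto
    with \<open>\<epsilon> > 0\<close> have "(norm (x - d n))\<^sup>2 < \<epsilon>"
      by simp
    then have "Re (g (x - d n) (x - d n)) < \<epsilon>"
      unfolding g_self by (smt (verit) zero_le_power2)
    then show ?thesis ..
  qed
  obtain D where D: "\<And>x y. D (x + y) = D x + D y" "\<And>c x. D (cscale c x) = cscale c (D x)"
    "\<And>x y. cinner (D x) (D y) = g x y"
    using g.isometry_into_ell2[where d = d, OF UNIV_I dense] by (metis UNIV_I)
  define V where "V z = join (S (left_part z)) (D z)" for z
  have "isometric V"
    using S D unfolding isometric_def clinear_op_def contractive_def
    by (simp add: V_def join_linear cinner_join g_def)
  then show thesis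
    by (rule that) (simp add: V_def)
qed

text \<open>
  On \<open>\<ell>\<^sup>2 \<oplus> \<ell>\<^sup>2\<close> the operator with the block matrix \<open>[[V, 1 - V V\<^sup>*], [0, V\<^sup>*]]\<close> is unitary when
  \<open>V\<^sup>* V = 1\<close>, and its inverse is its adjoint \<open>[[V\<^sup>*, 0], [1 - V V\<^sup>*, V]]\<close>.
\<close>

lemma unitary_extension:
  assumes V: "isometric V"
  obtains U U' where "unitary_op U U'" "\<And>x. U (join x 0) = join (V x) 0"
proof -
  obtain V' where V': "contractive V'" "\<And>x y. cinner (V x) y = cinner x (V' y)"
    using contractive_adjoint[OF isometric_contractive[OF V]] by metis
  have V'V: "V' (V x) = x" for x
    using V by (intro cinner_ext) (simp add: isometric_def flip: V'(2))
  have lin: "clinear_op V" "clinear_op V'"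
    using V V' by (simp_all add: isometric_def contractive_def)
  note diff = lin[THEN clinear_op_diff]
  have lin_simps: "V (x + y) = V x + V y" "V' (x + y) = V' x + V' y"
    "V (cscale c x) = cscale c (V x)" "V' (cscale c x) = cscale c (V' x)" for x y c
    using lin by (simp_all add: clinear_op_def)
  have adj: "cinner y (V x) = cinner (V' y) x" for x y
    using ell2.form_commute[of y "V x"] ell2.form_commute[of "V' y" x] V'(2)[of x y] by simp
  define U where "U z = join (V (left_part z) + (right_part z - V (V' (right_part z)))) (V' (right_part z))" for z
  define U' where "U' z = join (V' (left_part z)) (left_part z - V (V' (left_part z)) + V (right_part z))" for z
  have "unitary_op U U'"
    unfolding unitary_op_def clinear_op_def
  proof (intro conjI allI)
    fix x y :: ell2 and c
    show "U (x + y) = U x + U y" "U' (x + y) = U' x + U' y"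
      by (rule ell2_eqI; simp add: U_def U'_def join.rep_eq join_linear(3-) lin_simps)+
    show "U (cscale c x) = cscale c (U x)" "U' (cscale c x) = cscale c (U' x)"
      by (simp_all add: U_def U'_def join_linear lin_simps ell2.scale_right_distrib ell2.scale_right_diff_distrib)
    show "U' (U x) = x" "U (U' x) = x"
      by (simp_all add: U_def U'_def lin_simps diff V'V)
    show "cinner (U x) y = cinner x (U' y)"
    proof -
      have "cinner (join a b) (U' (join p q)) = cinner (U (join a b)) (join p q)" for a b p q
        by (simp add: U_def U'_def cinner_join ell2.form_add_left ell2.form_add_right
            ell2.form_diff_left ell2.form_diff_right V'(2) adj)
      then show ?thesis
        by (metis join_simps(3))
    qed
  qed
  then show thesis
    by (rule that) (simp add: U_def lin[THEN clinear_op_zero])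
qed

text \<open>
  The isometric dilation is lower triangular and the unitary extension is upper triangular, so the
  relevant corner of an \<open>n\<close>-th power is the \<open>n\<close>-th power of the corner.
\<close>

lemma unitary_dilation_ell2:
  assumes S: "contractive S"
  obtains U U' where "unitary_op U U'"
    "\<And>n x. left_part (left_part ((U ^^ n) (join (join x 0) 0))) = (S ^^ n) x"
proof -
  obtain V where V: "isometric V" "\<And>z. left_part (V z) = S (left_part z)"
    using isometric_dilation[OF S] by metis
  obtain U U' where U: "unitary_op U U'" "\<And>x. U (join x 0) = join (V x) 0"
    using unitary_extension[OF V(1)] by metis
  have "(U ^^ n) (join z 0) = join ((V ^^ n) z) 0" for n z
    by (induction n) (simp_all add: U(2))
  moreover have "left_part ((V ^^ n) z) = (S ^^ n) (left_part z)" for n z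
    by (induction n) (simp_all add: V(2))
  ultimately show thesis
    using U(1) by (intro that[of U U']) simp_all
qed

definition direct_sum :: "(ell2 \<Rightarrow> ell2) \<Rightarrow> (ell2 \<Rightarrow> ell2) \<Rightarrow> ell2 \<Rightarrow> ell2" where
  "direct_sum U W z = join (U (left_part z)) (W (right_part z))"

lemma unitary_direct_sum:
  assumes "unitary_op U U'" "unitary_op W W'"
  shows "unitary_op (direct_sum U W) (direct_sum U' W')"
proof -
  have "cinner (direct_sum U W (join a b)) (join p q) = cinner (join a b) (direct_sum U' W' (join p q))"
    for a b p q
    using assms by (simp add: unitary_op_def direct_sum_def cinner_join)
  then have "cinner (direct_sum U W x) y = cinner x (direct_sum U' W' y)" for x y
    by (metis join_simps(3))
  then show ?thesis
    using assms by (simp add: unitary_op_def clinear_op_def direct_sum_def join_linear)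
qed

lemma direct_sum_power: "(direct_sum U W ^^ n) z = join ((U ^^ n) (left_part z)) ((W ^^ n) (right_part z))"
  by (induction n) (simp_all add: direct_sum_def)

lift_definition alternate_signs :: "ell2 \<Rightarrow> ell2" is "\<lambda>x n. (- 1) ^ n * x n"
  by (simp add: norm_mult norm_power)

lemma unitary_id: "unitary_op (\<lambda>x. x) (\<lambda>x. x)"
  by (simp add: unitary_op_def clinear_op_def)

lemma unitary_alternate_signs: "unitary_op alternate_signs alternate_signs"
proof -
  have [simp]: "coord (alternate_signs x) n = (- 1) ^ n * coord x n" for x n
    by (simp add: alternate_signs.rep_eq)
  have "cinner (alternate_signs x) y = cinner x (alternate_signs y)" for x y
    by (simp add: cinner_def mult.left_commute mult.assoc)
  then show ?thesis
    unfolding unitary_op_def clinear_op_def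
    by (auto intro!: ell2_eqI simp: distrib_left mult.left_commute)
qed

lemma norm_unitary_op: "unitary_op U U' \<Longrightarrow> norm (U x) = norm x"
  unfolding unitary_op_def by (metis Re_cinner_self norm_ge_zero power2_eq_imp_eq)

section \<open>Hilbert spaces given by carriers\<close>

sublocale complex_inner_product_space \<subseteq> form: semi_inner_product "scl H" "carrier H" "ip H"
proof
  show "subspace (carrier H)" by (rule subspace_carrier)
  show "ip H x y = cnj (ip H y x)" if "x \<in> carrier H" "y \<in> carrier H" for x y
    using that by (rule ip_commute)
qed (simp_all add: ip_add_left ip_scl_left ip_nonneg)

text \<open>
  The supremum in \<open>op_norm\<close> bounds the values only because it is taken over a bounded set, which is
  where boundedness of \<open>T\<close> enters.
\<close>

lemma (in complex_inner_product_space) contraction_norm_le: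
  assumes "contraction H T" and x: "x \<in> carrier H"
  shows "vnorm H (T x) \<le> vnorm H x"
proof (cases "x = 0")
  case True
  have lin: "linear_on_carrier H H T"
    using assms by (simp add: contraction_def bounded_operator_def)
  then have "T 0 = 0"
    unfolding linear_on_carrier_def by (metis scale_zero_left zero_in)
  with True show ?thesis by simp
next
  case False
  have lin: "linear_on_carrier H H T"
    using assms by (simp add: contraction_def bounded_operator_def)
  obtain B where B: "\<And>y. y \<in> carrier H \<Longrightarrow> vnorm H (T y) \<le> B * vnorm H y"
    using assms by (auto simp: contraction_def bounded_operator_def)
  define r where "r = vnorm H x"
  have r: "r > 0"
    using False x vnorm_nonneg[OF x] vnorm_eq_0_iff[OF x] by (simp add: r_def)
  have vnorm_scl: "vnorm H (scl H (of_real (1 / r)) y) = vnorm H y / r" if "y \<in> carrier H" for y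
    using that r by (simp add: vnorm_def ip_scl_left ip_scl_right real_sqrt_divide flip: power2_eq_square)
  define y where "y = scl H (of_real (1 / r)) x"
  have y: "y \<in> carrier H" "vnorm H y \<le> 1"
    using x r vnorm_scl[OF x, folded y_def] by (simp_all add: y_def flip: r_def)
  have "vnorm H (T z) \<le> \<bar>B\<bar>" if "z \<in> carrier H" "vnorm H z \<le> 1" for z
  proof -
    have "B * vnorm H z \<le> \<bar>B\<bar> * 1"
      using that vnorm_nonneg[of z] by (intro mult_mono) auto
    with B[OF that(1)] show ?thesis by simp
  qed
  then have "vnorm H (T y) \<le> op_norm H T"
    unfolding op_norm_def using y by (intro cSUP_upper bdd_aboveI2[where M = "\<bar>B\<bar>"]) auto
  also have "\<dots> \<le> 1"
    using assms by (simp add: contraction_def)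
  finally have "vnorm H (T x) / r \<le> 1"
    using lin x vnorm_scl by (simp add: y_def linear_on_carrier_def)
  with r show ?thesis by (simp add: r_def)
qed

lemma (in separable_hilbert_space) dense_sequence:
  obtains d :: "nat \<Rightarrow> 'a" where "\<And>n. d n \<in> carrier H"
    "\<And>x \<epsilon>. x \<in> carrier H \<Longrightarrow> \<epsilon> > 0 \<Longrightarrow> \<exists>n. Re (ip H (x - d n) (x - d n)) < \<epsilon>"
proof -
  obtain D where D: "countable D" "D \<subseteq> carrier H"
      "vmetric.mtopology closure_of D = carrier H"
    using separable by (auto simp: separable_space_def)
  have near: "\<exists>y\<in>D. vnorm H (x - y) < r" if "x \<in> carrier H" "r > 0" for x r
    using that D(3) by (auto simp: vmetric.metric_closure_of vdist_def split: if_splits)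
  have "D \<noteq> {}"
    using near[of 0 1] by auto
  then have range: "range (from_nat_into D) = D"
    using D(1) by (rule range_from_nat_into)
  show thesis
  proof (rule that[of "from_nat_into D"])
    show inC: "from_nat_into D n \<in> carrier H" for n
      using range D(2) by blast
    fix x :: 'a and \<epsilon> :: real
    assume x: "x \<in> carrier H" and \<epsilon>: "\<epsilon> > 0"
    obtain y where "y \<in> D" "vnorm H (x - y) < sqrt \<epsilon>"
      using near[OF x, of "sqrt \<epsilon>"] \<epsilon> by auto
    then obtain n where n: "sqrt (Re (ip H (x - from_nat_into D n) (x - from_nat_into D n))) < sqrt \<epsilon>"
      using range unfolding vnorm_def by (metis rangeE)
    then show "\<exists>n. Re (ip H (x - from_nat_into D n) (x - from_nat_into D n)) < \<epsilon>"
      by (auto simp: real_sqrt_less_iff)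
  qed
qed

definition ell2_space :: "(nat \<Rightarrow> complex) cspace" where
  "ell2_space = \<lparr>carrier = range coord, scl = (\<lambda>c f n. c * f n),
     ip = (\<lambda>f g. cinner (of_coord f) (of_coord g))\<rparr>"

lemma ell2_space_simps:
  "carrier ell2_space = range coord"
  "scl ell2_space c (coord x) = coord (cscale c x)"
  "ip ell2_space (coord x) (coord y) = cinner x y"
  "vnorm ell2_space (coord x) = norm x"
  "coord x + coord y = coord (x + y)" "coord x - coord y = coord (x - y)" "0 = coord 0"
  by (auto simp: ell2_space_def vnorm_def coord_inverse Re_cinner_self fun_eq_iff)

lemma complex_inner_product_space_ell2: "complex_inner_product_space ell2_space"
proof -
  interpret vector_space "scl ell2_space"
    by unfold_locales (auto simp: ell2_space_def fun_eq_iff algebra_simps)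
  show ?thesis
  proof
    show "subspace (carrier ell2_space)"
      unfolding subspace_def by (auto simp: ell2_space_simps(1,2,5,7))
    fix x y z :: "nat \<Rightarrow> complex" and c
    assume x: "x \<in> carrier ell2_space"
    then obtain x' where x': "x = coord x'" by (auto simp: ell2_space_simps)
    show "0 \<le> Re (ip ell2_space x x)"
      by (simp add: x' ell2_space_simps Re_cinner_self)
    show "x = 0" if "ip ell2_space x x = 0"
      using that Re_cinner_self[of x'] by (simp add: x' ell2_space_simps(3)) (simp add: ell2_space_simps(7))
    assume y: "y \<in> carrier ell2_space"
    then obtain y' where y': "y = coord y'" by (auto simp: ell2_space_simps)
    show "ip ell2_space (scl ell2_space c x) y = c * ip ell2_space x y"
      by (simp add: x' y' ell2_space_simps(2,3) ell2.form_scl_left)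
    show "ip ell2_space x y = cnj (ip ell2_space y x)"
      unfolding x' y' ell2_space_simps by (rule ell2.form_commute) auto
    assume z: "z \<in> carrier ell2_space"
    then obtain z' where z': "z = coord z'" by (auto simp: ell2_space_simps)
    show "ip ell2_space (x + y) z = ip ell2_space x z + ip ell2_space y z"
      by (simp add: x' y' z' ell2_space_simps(3,5) ell2.form_add_left)
  qed
qed

interpretation ell2_space: complex_inner_product_space ell2_space
  by (rule complex_inner_product_space_ell2)

lemma vdist_ell2: "vdist ell2_space (coord x) (coord y) = dist x y"
  by (simp add: vdist_def ell2_space_simps(1,4,6) dist_norm)

lemma separable_hilbert_space_ell2: "separable_hilbert_space ell2_space"
proof
  show "ell2_space.vmetric.mcomplete"
    unfolding ell2_space.vmetric.mcomplete_def
  proof (intro allI impI)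
    fix \<sigma> :: "nat \<Rightarrow> nat \<Rightarrow> complex"
    assume \<sigma>: "ell2_space.vmetric.MCauchy \<sigma>"
    then have "\<sigma> n \<in> range coord" for n
      unfolding ell2_space.vmetric.MCauchy_def by (auto simp: ell2_space_simps(1))
    then have coord_of_coord: "coord (of_coord (\<sigma> n)) = \<sigma> n" for n
      by (metis coord_inverse imageE)
    define X where "X n = of_coord (\<sigma> n)" for n
    have X: "\<sigma> n = coord (X n)" for n
      unfolding X_def by (rule coord_of_coord[symmetric])
    have dist: "vdist ell2_space (\<sigma> m) (\<sigma> n) = dist (X m) (X n)" for m n
      unfolding X by (rule vdist_ell2)
    have "Cauchy X"
      using \<sigma> unfolding ell2_space.vmetric.MCauchy_def Cauchy_def dist by simp
    then obtain l where l: "X \<longlonglongrightarrow> l"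
      using Cauchy_convergent_iff convergent_def by blast
    have "limitin ell2_space.vmetric.mtopology \<sigma> (coord l) sequentially"
      using l unfolding ell2_space.vmetric.limit_metric_sequentially lim_sequentially X vdist_ell2
      by (simp add: ell2_space_simps(1))
    then show "\<exists>x. limitin ell2_space.vmetric.mtopology \<sigma> x sequentially"
      by (rule exI[of _ "coord l"])
  qed
  show "separable_space ell2_space.vmetric.mtopology"
  proof -
    obtain d :: "nat \<Rightarrow> ell2" where d: "\<And>x \<epsilon>. \<epsilon> > 0 \<Longrightarrow> \<exists>n. norm (x - d n) < \<epsilon>"
      using ell2_dense_sequence by metis
    have near: "\<exists>g\<in>coord ` range d. f \<in> carrier ell2_space \<and> g \<in> carrier ell2_space \<and> vdist ell2_space f g < r"
      if f: "f \<in> carrier ell2_space" and r: "r > 0" for f r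
    proof -
      obtain x where x: "f = coord x"
        using f by (auto simp: ell2_space_simps(1))
      obtain n where "norm (x - d n) < r"
        using d[OF r] by blast
      then show ?thesis
        by (intro bexI[of _ "coord (d n)"]) (simp_all add: x vdist_ell2 dist_norm ell2_space_simps(1))
    qed
    have "ell2_space.vmetric.mtopology closure_of (coord ` range d) = carrier ell2_space"
      unfolding ell2_space.vmetric.metric_closure_of ell2_space.vmetric.in_mball
      by (intro equalityI subsetI CollectI conjI allI impI near) (erule CollectE, erule conjunct1)
    moreover have "coord ` range d \<subseteq> carrier ell2_space"
      by (auto simp: ell2_space_simps(1))
    ultimately show ?thesis
      unfolding separable_space_def ell2_space.vmetric.topspace_mtopology
      by (intro exI[of _ "coord ` range d"] conjI countable_image countableI_type)
  qed
qed

definition on_coords :: "(ell2 \<Rightarrow> ell2) \<Rightarrow> (nat \<Rightarrow> complex) \<Rightarrow> nat \<Rightarrow> complex" where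
  "on_coords U f = coord (U (of_coord f))"

lemma on_coords_coord [simp]: "on_coords U (coord x) = coord (U x)"
  by (simp add: on_coords_def coord_inverse)

lemma on_coords_power: "(on_coords U ^^ n) (coord x) = coord ((U ^^ n) x)"
  by (induction n) simp_all

lemma unitary_on_coords:
  assumes "unitary_op U U'"
  shows "unitary ell2_space (on_coords U)"
proof -
  have bounded: "bounded_operator ell2_space (on_coords W)" if "clinear_op W" "\<And>x. norm (W x) = norm x" for W
    using that unfolding bounded_operator_def linear_on_carrier_def clinear_op_def
    by (auto simp: ell2_space_simps(1,2,4,5) intro!: exI[of _ 1])
  have "cinner (U' x) y = cinner x (U y)" for x y
    using assms ell2.form_commute[of "U' x" y] ell2.form_commute[of x "U y"]
    by (simp add: unitary_op_def)
  then have inverse: "unitary_op U' U"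
    using assms by (simp add: unitary_op_def)
  have "bounded_operator ell2_space (on_coords U)"
    by (rule bounded[OF _ norm_unitary_op[OF assms]]) (use assms in \<open>simp add: unitary_op_def\<close>)
  moreover have "bounded_operator ell2_space (on_coords U')"
    by (rule bounded[OF _ norm_unitary_op[OF inverse]]) (use assms in \<open>simp add: unitary_op_def\<close>)
  moreover have "is_adjoint ell2_space (on_coords U) (on_coords U')"
    using assms by (auto simp: is_adjoint_def ell2_space_simps(1,3) unitary_op_def)
  moreover have "\<forall>x\<in>carrier ell2_space. on_coords U' (on_coords U x) = x \<and> on_coords U (on_coords U' x) = x"
    using assms by (auto simp: ell2_space_simps(1) unitary_op_def)
  ultimately show ?thesis
    unfolding unitary_def by blast
qed

lemma op_norm_on_coords:
  assumes "\<And>x. F (coord x) = coord (T x)" "\<And>x. norm (T x) \<le> B * norm x"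
  shows "norm x \<le> 1 \<Longrightarrow> norm (T x) \<le> op_norm ell2_space F"
    and "0 \<le> B \<Longrightarrow> op_norm ell2_space F \<le> B"
proof -
  have le: "norm (T x) \<le> \<bar>B\<bar>" if "norm x \<le> 1" for x
  proof -
    have "B * norm x \<le> \<bar>B\<bar> * 1"
      using that by (intro mult_mono) auto
    with assms(2)[of x] show ?thesis by simp
  qed
  have op: "op_norm ell2_space F = (SUP x\<in>{x. norm x \<le> 1}. norm (T x))"
  proof -
    have "{f \<in> carrier ell2_space. vnorm ell2_space f \<le> 1} = coord ` {x. norm x \<le> 1}"
      by (auto simp: ell2_space_simps)
    then show ?thesis
      by (simp add: op_norm_def image_image assms(1) ell2_space_simps(4))
  qed
  show "norm (T x) \<le> op_norm ell2_space F" if "norm x \<le> 1"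
    unfolding op using that le by (intro cSUP_upper bdd_aboveI2[where M = "\<bar>B\<bar>"]) auto
  show "op_norm ell2_space F \<le> B" if "0 \<le> B"
    unfolding op using that le by (intro cSUP_least) (auto intro: exI[of _ 0])
qed

text \<open>
  The second summands decide: on unit vectors with even and odd index, the operator
  \<open>1 + c G\<close>, where \<open>G\<close> alternates signs, is multiplication by \<open>1 + c\<close> and by \<open>1 - c\<close>. One of these two
  numbers has modulus at least \<open>1\<close>, which is the norm of the first operator.
\<close>

lemma bj_orthogonal_direct_sum:
  assumes U: "unitary_op U U'" and A: "unitary_op A A'"
  shows "bj_orthogonal ell2_space (on_coords (direct_sum U (\<lambda>x. x)))
    (on_coords (direct_sum A alternate_signs))"
proof -
  let ?U = "direct_sum U (\<lambda>x. x)" and ?A = "direct_sum A alternate_signs"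
  have norm_U: "norm (?U z) = norm z" and norm_A: "norm (?A z) = norm z" for z
    using norm_unitary_op unitary_direct_sum U A unitary_id unitary_alternate_signs by blast+
  have zero: "U 0 = 0" "A 0 = 0"
    using U A by (simp_all add: unitary_op_def clinear_op_zero)
  have le: "op_norm ell2_space (on_coords ?U) \<le> 1"
    using op_norm_on_coords(2)[of "on_coords ?U" ?U 1] norm_U by simp
  have "1 \<le> op_norm ell2_space (\<lambda>x. on_coords ?U x + scl ell2_space c (on_coords ?A x))" for c
  proof -
    define T where "T z = ?U z + cscale c (?A z)" for z
    have bound: "norm (T z) \<le> (1 + cmod c) * norm z" for z
      using norm_triangle_ineq[of "?U z" "cscale c (?A z)"]
      by (simp add: T_def norm_cscale norm_U norm_A algebra_simps)
    have norm_v: "norm (join 0 (unit_vec n)) = 1" for n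
      using norm_join[of 0 "unit_vec n"] norm_ge_zero[of "join 0 (unit_vec n)"]
      by (simp add: power2_eq_1_iff)
    have T_v: "norm (T (join 0 (unit_vec n))) = cmod (1 + c * (- 1) ^ n)" for n
    proof -
      have "T (join 0 (unit_vec n)) = cscale (1 + c * (- 1) ^ n) (join 0 (unit_vec n))"
        by (rule ell2_eqI)
           (simp add: T_def direct_sum_def zero join.rep_eq alternate_signs.rep_eq coord_unit_vec algebra_simps)
      then show ?thesis
        by (simp add: norm_cscale norm_v)
    qed
    have "cmod (1 + c * (- 1) ^ n) \<le>
        op_norm ell2_space (\<lambda>x. on_coords ?U x + scl ell2_space c (on_coords ?A x))" for n
      using op_norm_on_coords(1)[of _ T "1 + cmod c" "join 0 (unit_vec n)", OF _ bound]
      unfolding T_v by (simp add: norm_v T_def ell2_space_simps(2,5))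
    from this[of 0] this[of 1] show ?thesis
      using norm_triangle_ineq[of "1 + c" "1 - c"] by simp
  qed
  with le show ?thesis
    unfolding bj_orthogonal_def by (meson order_trans)
qed

text \<open>
  Compressions are computed from inner products alone: if \<open>z\<close> pairs with the image of \<open>J\<close> as \<open>J x\<close>
  does, then \<open>J x\<close> is the projection of \<open>z\<close>, and definiteness makes it the only candidate.
\<close>

lemma orth_proj_isometric_image:
  assumes "complex_inner_product_space H" "complex_inner_product_space K"
    and J: "isometric_embedding H K J"
    and x: "x \<in> carrier H" and z: "z \<in> carrier K"
    and orth: "\<And>m. m \<in> carrier H \<Longrightarrow> ip K z (J m) = ip H x m"
  shows "orth_proj K (J ` carrier H) z = J x"
proof -
  interpret H: complex_inner_product_space H by fact
  interpret K: complex_inner_product_space K by fact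
  have J_in: "J a \<in> carrier K" if "a \<in> carrier H" for a
    using J that by (simp add: isometric_embedding_def linear_on_carrier_def)
  have J_ip: "ip K (J a) (J b) = ip H a b" if "a \<in> carrier H" "b \<in> carrier H" for a b
    using J that by (simp add: isometric_embedding_def)
  have ip_diff: "ip K (z - J a) (J m) = ip H (x - a) m" if "a \<in> carrier H" "m \<in> carrier H" for a m
    using that x z orth J_in J_ip by (simp add: K.form.form_diff_left H.form.form_diff_left)
  show ?thesis
    unfolding orth_proj_def
  proof (rule the_equality)
    show "J x \<in> J ` carrier H \<and> (\<forall>m\<in>J ` carrier H. ip K (z - J x) m = 0)"
      using x ip_diff by auto
  next
    fix p
    assume p: "p \<in> J ` carrier H \<and> (\<forall>m\<in>J ` carrier H. ip K (z - p) m = 0)"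
    then obtain a where a: "a \<in> carrier H" "p = J a" by blast
    then have "ip H (x - a) (x - a) = 0"
      using p ip_diff x by (metis H.diff_in imageI)
    then have "x - a = 0"
      using a x by (intro H.ip_definite) simp_all
    with a show "p = J x" by simp
  qed
qed

section \<open>Birkhoff--James orthogonal unitary dilations\<close>

theorem theorem6p2:
  fixes H :: "('a::ab_group_add) cspace" and T A :: "'a \<Rightarrow> 'a"
  assumes "separable_hilbert_space H"
    and "contraction H T" and "contraction H A"
    and "bj_orthogonal H T A"
  shows "\<exists>(K :: (nat \<Rightarrow> complex) cspace) (J :: 'a \<Rightarrow> nat \<Rightarrow> complex) U\<^sub>T U\<^sub>A.
    separable_hilbert_space K \<and> isometric_embedding H K J \<and>
    unitary_dilation H K J T U\<^sub>T \<and> unitary_dilation H K J A U\<^sub>A \<and>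
    bj_orthogonal K U\<^sub>T U\<^sub>A"
proof -
  interpret separable_hilbert_space H by fact
  obtain d :: "nat \<Rightarrow> 'a" where d: "\<And>n. d n \<in> carrier H"
    "\<And>x \<epsilon>. x \<in> carrier H \<Longrightarrow> \<epsilon> > 0 \<Longrightarrow> \<exists>n. Re (ip H (x - d n) (x - d n)) < \<epsilon>"
    using dense_sequence by blast
  obtain \<Phi> where \<Phi>:
    "\<And>x y. x \<in> carrier H \<Longrightarrow> y \<in> carrier H \<Longrightarrow> \<Phi> (x + y) = \<Phi> x + \<Phi> y"
    "\<And>c x. x \<in> carrier H \<Longrightarrow> \<Phi> (scl H c x) = cscale c (\<Phi> x)"
    "\<And>x y. x \<in> carrier H \<Longrightarrow> y \<in> carrier H \<Longrightarrow> cinner (\<Phi> x) (\<Phi> y) = ip H x y"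
    and extend: "\<And>T. form.contractive_on T \<Longrightarrow>
       \<exists>S. contractive S \<and> (\<forall>x\<in>carrier H. S (\<Phi> x) = \<Phi> (T x))"
    using form.isometry_extending_contractions[OF d] by blast
  \<comment> \<open>The three layers of \<open>join\<close> make room for the isometric dilation, for its unitary extension and
    for the summand that forces orthogonality.\<close>
  define J where "J x = coord (join (join (join (\<Phi> x) 0) 0) 0)" for x
  have J: "isometric_embedding H ell2_space J"
    unfolding isometric_embedding_def linear_on_carrier_def J_def
    by (auto simp: ell2_space_simps(1,2,3,5) \<Phi> cinner_join join_linear(2) simp flip: join_linear(1))
  have dilation: "\<exists>U U'. unitary_op U U' \<and>
      (\<forall>W W'. unitary_op W W' \<longrightarrow> unitary_dilation H ell2_space J B (on_coords (direct_sum U W)))"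
    if B: "contraction H B" for B
  proof -
    have lin: "B x \<in> carrier H" "y \<in> carrier H \<Longrightarrow> B (x + y) = B x + B y"
      "B (scl H c x) = scl H c (B x)"
      if "x \<in> carrier H" for x y c
      using B that by (simp_all add: contraction_def bounded_operator_def linear_on_carrier_def)
    have "Re (ip H (B x) (B x)) \<le> Re (ip H x x)" if "x \<in> carrier H" for x
      using contraction_norm_le[OF B that] by (simp add: vnorm_def)
    then have "form.contractive_on B"
      by (simp add: form.contractive_on_def lin)
    then obtain S where S: "contractive S" "\<And>x. x \<in> carrier H \<Longrightarrow> S (\<Phi> x) = \<Phi> (B x)"
      using extend[of B] by blast
    have power_in: "(B ^^ n) x \<in> carrier H" if "x \<in> carrier H" for n x
      using that lin(1) by (induction n) auto
    have S_power: "(S ^^ n) (\<Phi> x) = \<Phi> ((B ^^ n) x)" if "x \<in> carrier H" for n x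
      using that power_in S(2) by (induction n) auto
    obtain U U' where U: "unitary_op U U'"
      "\<And>n x. left_part (left_part ((U ^^ n) (join (join x 0) 0))) = (S ^^ n) x"
      using unitary_dilation_ell2[OF S(1)] by metis
    have "unitary_dilation H ell2_space J B (on_coords (direct_sum U W))" if W: "unitary_op W W'" for W W'
      unfolding unitary_dilation_def
    proof (intro conjI allI ballI)
      show "unitary ell2_space (on_coords (direct_sum U W))"
        by (rule unitary_on_coords[OF unitary_direct_sum[OF U(1) W]])
      fix n x
      assume x: "x \<in> carrier H"
      define z where "z = (direct_sum U W ^^ n) (join (join (join (\<Phi> x) 0) 0) 0)"
      have z: "(on_coords (direct_sum U W) ^^ n) (J x) = coord z"
        by (simp add: J_def z_def on_coords_power)
      have compress: "cinner z (join (join (join (\<Phi> m) 0) 0) 0) = ip H ((B ^^ n) x) m"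
        if m: "m \<in> carrier H" for m
      proof -
        have "cinner w (join y 0) = cinner (left_part w) y" for w y
          using cinner_join[of "left_part w" "right_part w" y 0] by simp
        then have "cinner z (join (join (join (\<Phi> m) 0) 0) 0) = cinner ((S ^^ n) (\<Phi> x)) (\<Phi> m)"
          by (simp add: z_def direct_sum_power U(2))
        then show ?thesis
          using x m power_in by (simp add: S_power \<Phi>(3))
      qed
      show "J ((B ^^ n) x) = orth_proj ell2_space (J ` carrier H) ((on_coords (direct_sum U W) ^^ n) (J x))"
        unfolding z
      proof (rule orth_proj_isometric_image[symmetric, OF complex_inner_product_space_axioms
            complex_inner_product_space_ell2 J power_in[OF x]])
        show "coord z \<in> carrier ell2_space"
          by (simp add: ell2_space_simps(1))
        show "ip ell2_space (coord z) (J m) = ip H ((B ^^ n) x) m" if "m \<in> carrier H" for m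
          using compress[OF that] by (simp add: J_def ell2_space_simps(3))
      qed
    qed
    with U(1) show ?thesis by blast
  qed
  obtain U U' where U: "unitary_op U U'"
    "\<And>W W'. unitary_op W W' \<Longrightarrow> unitary_dilation H ell2_space J T (on_coords (direct_sum U W))"
    using dilation[OF assms(2)] by blast
  obtain V V' where V: "unitary_op V V'"
    "\<And>W W'. unitary_op W W' \<Longrightarrow> unitary_dilation H ell2_space J A (on_coords (direct_sum V W))"
    using dilation[OF assms(3)] by blast
  show ?thesis
    using separable_hilbert_space_ell2 J U(2)[OF unitary_id] V(2)[OF unitary_alternate_signs]
      bj_orthogonal_direct_sum[OF U(1) V(1)] by blast
qed

end
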